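(* Let $k$ be a finite field of characteristic $p>2$, and let $G$ be the infinite dimensional unitary Grassmann algebra over $k$. Let $$S_1=\{\,[x_1,x_2],\ x_1^p\,\}^S+\Bigl\{\,x_1^p\prod_{i=1}^t [x_{2i},x_{2i+1}]\,x_{2i}^{p-1}x_{2i+1}^{p-1}\ \Big|\ t\ge 1\Bigr\}^S .$$ Then $$CP(G)=S_1+T(G).$$
   Context: $X=\{x_i\mid i\ge 1\}$ is a countably infinite set and $k_1\langle X\rangle$ is the free unitary associative $k$-algebra over $X$; $[a,b]=ab-ba$. A $T$-space of $k_1\langle X\rangle$ is a $k$-linear subspace that is invariant under all (unitary) algebra endomorphisms of $k_1\langle X\rangle$. For $B\subseteq k_1\langle X\rangle$, $B^S$ denotes the smallest $T$-space of $k_1\langle X\rangle$ containing $B$. $G$ is the unitary associative $k$-algebra generated by elements $e_i$, $i\ge1$, with $e_ie_j=-e_je_i$ and $e_i^2=0$ for all $i,j$, having as linear basis $1$ together with $\{e_{i_1}e_{i_2}\cdots e_{i_n}\mid n\ge1,\ i_1<i_2<\cdots<i_n\}$. $T(G)\subseteq k_1\langle X\rangle$ is the set of all $f\in k_1\langle X\rangle$ that lie in the kernel of every unitary $k$-algebra homomorphism $k_1\langle X\rangle\to G$. An element $f\in k_1\langle X\rangle$ is a central polynomial of $G$ if $f\notin T(G)$ and the image of $f$ under every unitary $k$-algebra homomorphism $k_1\langle X\rangle\to G$ lies in the centre of $G$. $CP(G)$ denotes the $T$-space of $k_1\langle X\rangle$ generated by the set of all central polynomials of $G$. *)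

theory Defs
  imports Complex_Main "HOL-Library.Poly_Mapping" "HOL-Library.Set_Algebras"
    "HOL-Computational_Algebra.Primes"
begin

section \<open>The free unitary associative algebra over a countably infinite set\<close>

datatype 'x free_monoid = Free_Monoid "'x list"

instantiation free_monoid :: (type) monoid_add
begin

definition zero_free_monoid :: "'a free_monoid"
  where "0 = Free_Monoid []"

fun plus_free_monoid :: "'a free_monoid \<Rightarrow> 'a free_monoid \<Rightarrow> 'a free_monoid"
  where "Free_Monoid u + Free_Monoid v = Free_Monoid (u @ v)"

instance
proof
  fix a b c :: "'a free_monoid"
  show "a + b + c = a + (b + c)" by (cases a; cases b; cases c) simp
  show "0 + a = a" by (cases a) (simp add: zero_free_monoid_def)
  show "a + 0 = a" by (cases a) (simp add: zero_free_monoid_def)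
qed

end

text \<open>The monoid algebra of the free monoid. The monoid is written additively because the
  convolution product of \<open>Poly_Mapping\<close> is stated for additive monoids; it is not commutative.\<close>

type_synonym 'k free_alg = "nat free_monoid \<Rightarrow>\<^sub>0 'k"

definition fscale :: "'k::field \<Rightarrow> 'k free_alg \<Rightarrow> 'k free_alg"
  where "fscale c f = Poly_Mapping.map ((*) c) f"

lemma lookup_fscale [simp]:
  "Poly_Mapping.lookup (fscale c f) w = c * Poly_Mapping.lookup f w"
  by (simp add: fscale_def map.rep_eq when_def)

lemma fscale_eq_mult: "fscale c f = Poly_Mapping.single 0 c * f"
  by (rule poly_mapping_eqI)
    (simp only: lookup_fscale mult_map_scale_conv_mult [symmetric] fscale_def [symmetric])

interpretation free_alg: vector_space fscale
  by standard (auto intro!: poly_mapping_eqI simp: lookup_add algebra_simps)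

text \<open>The variables are \<open>x\<^sub>i\<close> with \<open>i \<ge> 1\<close>: the letter \<open>n :: nat\<close> stands for
  \<open>x\<^bsub>n+1\<^esub>\<close>, and \<open>X i\<close> is only meant for \<open>i \<ge> 1\<close>.\<close>

definition X :: "nat \<Rightarrow> 'k::field free_alg"
  where "X i = Poly_Mapping.single (Free_Monoid [i - 1]) 1"

definition commutator :: "'a::ring \<Rightarrow> 'a \<Rightarrow> 'a"
  where "commutator a b = a * b - b * a"


section \<open>The infinite dimensional unitary Grassmann algebra\<close>

text \<open>An element is given by its coefficients with respect to the basis of the products
  \<open>e\<^sub>A\<close>, for finite index sets \<open>A\<close>, of the generators \<open>e\<^sub>i\<close> with \<open>i \<in> A\<close> in increasing order. If \<open>A\<close>
  and \<open>B\<close> are disjoint, then \<open>e\<^sub>A e\<^sub>B = (-1)\<^sup>m e\<^bsub>A \<union> B\<^esub>\<close>, where \<open>m\<close> is the number of inversions between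
  \<open>A\<close> and \<open>B\<close>; otherwise \<open>e\<^sub>A e\<^sub>B = 0\<close>. The generators \<open>gen i\<close> are indexed from 0 instead of 1.\<close>

typedef (overloaded) 'k grassmann =
  "{f :: nat set \<Rightarrow> 'k::zero. finite {A. f A \<noteq> 0} \<and> (\<forall>A. f A \<noteq> 0 \<longrightarrow> finite A)}"
  morphisms gcoeff Abs_grassmann
  by (rule exI [of _ "\<lambda>_. 0"]) simp

setup_lifting type_definition_grassmann

lemma grassmann_eqI: "(\<And>A. gcoeff f A = gcoeff g A) \<Longrightarrow> f = g"
  by transfer auto

lemma finite_gsupp: "finite {A. gcoeff f A \<noteq> 0}"
  by transfer simp

lemma gcoeff_infinite: "infinite A \<Longrightarrow> gcoeff f A = 0"
  by transfer auto

definition gsign :: "nat set \<Rightarrow> nat set \<Rightarrow> 'k::field"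
  where "gsign A B = (- 1) ^ card {(a, b). a \<in> A \<and> b \<in> B \<and> b < a}"

lemma gsign_empty [simp]: "gsign {} B = 1" "gsign A {} = 1"
  by (simp_all add: gsign_def)

lemma finite_inversions:
  "finite A \<Longrightarrow> finite B \<Longrightarrow> finite {(a::nat, b). a \<in> A \<and> b \<in> B \<and> b < a}"
  by (rule finite_subset [of _ "A \<times> B"]) auto

lemma gsign_Un_left:
  assumes "finite A" "finite B" "finite C" "A \<inter> B = {}"
  shows "gsign (A \<union> B) C = gsign A C * gsign B C"
proof -
  have "{(a, b). a \<in> A \<union> B \<and> b \<in> C \<and> b < a} =
      {(a, b). a \<in> A \<and> b \<in> C \<and> b < a} \<union> {(a, b). a \<in> B \<and> b \<in> C \<and> b < a}"
    by auto
  moreover have "card \<dots> =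
      card {(a, b). a \<in> A \<and> b \<in> C \<and> b < a} + card {(a, b). a \<in> B \<and> b \<in> C \<and> b < a}"
    by (rule card_Un_disjoint) (use assms in \<open>auto intro: finite_inversions\<close>)
  ultimately show ?thesis by (simp add: gsign_def power_add)
qed

lemma gsign_Un_right:
  assumes "finite A" "finite B" "finite C" "B \<inter> C = {}"
  shows "gsign A (B \<union> C) = gsign A B * gsign A C"
proof -
  have "{(a, b). a \<in> A \<and> b \<in> B \<union> C \<and> b < a} =
      {(a, b). a \<in> A \<and> b \<in> B \<and> b < a} \<union> {(a, b). a \<in> A \<and> b \<in> C \<and> b < a}"
    by auto
  moreover have "card \<dots> =
      card {(a, b). a \<in> A \<and> b \<in> B \<and> b < a} + card {(a, b). a \<in> A \<and> b \<in> C \<and> b < a}"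
    by (rule card_Un_disjoint) (use assms in \<open>auto intro: finite_inversions\<close>)
  ultimately show ?thesis by (simp add: gsign_def power_add)
qed

instantiation grassmann :: (field) ring_1
begin

lift_definition zero_grassmann :: "'a grassmann" is "\<lambda>_. 0"
  by simp

lift_definition one_grassmann :: "'a grassmann" is "\<lambda>A. if A = {} then 1 else 0"
  by simp

lift_definition plus_grassmann :: "'a grassmann \<Rightarrow> 'a grassmann \<Rightarrow> 'a grassmann"
  is "\<lambda>f g A. f A + g A"
proof -
  fix f g :: "nat set \<Rightarrow> 'a"
  assume *: "finite {A. f A \<noteq> 0} \<and> (\<forall>A. f A \<noteq> 0 \<longrightarrow> finite A)"
    "finite {A. g A \<noteq> 0} \<and> (\<forall>A. g A \<noteq> 0 \<longrightarrow> finite A)"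
  have "{A. f A + g A \<noteq> 0} \<subseteq> {A. f A \<noteq> 0} \<union> {A. g A \<noteq> 0}" by auto
  with * show "finite {A. f A + g A \<noteq> 0} \<and> (\<forall>A. f A + g A \<noteq> 0 \<longrightarrow> finite A)"
    by (metis (no_types, lifting) add.right_neutral finite_Un finite_subset)
qed

lift_definition uminus_grassmann :: "'a grassmann \<Rightarrow> 'a grassmann" is "\<lambda>f A. - f A"
  by simp

definition minus_grassmann :: "'a grassmann \<Rightarrow> 'a grassmann \<Rightarrow> 'a grassmann"
  where "f - g = f + (- g :: 'a grassmann)"

lift_definition times_grassmann :: "'a grassmann \<Rightarrow> 'a grassmann \<Rightarrow> 'a grassmann"
  is "\<lambda>f g C. \<Sum>A\<in>Pow C. gsign A (C - A) * f A * g (C - A)"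
proof (intro conjI allI impI)
  fix f g :: "nat set \<Rightarrow> 'a"
  let ?h = "\<lambda>C. \<Sum>A\<in>Pow C. gsign A (C - A) * f A * g (C - A)"
  assume *: "finite {A. f A \<noteq> 0} \<and> (\<forall>A. f A \<noteq> 0 \<longrightarrow> finite A)"
    "finite {A. g A \<noteq> 0} \<and> (\<forall>A. g A \<noteq> 0 \<longrightarrow> finite A)"
  have "{C. ?h C \<noteq> 0} \<subseteq> (\<lambda>(A, B). A \<union> B) ` ({A. f A \<noteq> 0} \<times> {A. g A \<noteq> 0})"
  proof
    fix C assume "C \<in> {C. ?h C \<noteq> 0}"
    then obtain A where "A \<subseteq> C" "f A \<noteq> 0" "g (C - A) \<noteq> 0"
      by (auto elim: sum.not_neutral_contains_not_neutral)
    then show "C \<in> (\<lambda>(A, B). A \<union> B) ` ({A. f A \<noteq> 0} \<times> {A. g A \<noteq> 0})"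
      by (intro image_eqI [of _ _ "(A, C - A)"]) auto
  qed
  then show "finite {C. ?h C \<noteq> 0}"
    by (rule finite_subset) (use * in auto)
  fix C assume "?h C \<noteq> 0"
  then show "finite C" by (metis (lifting) finite_Pow_iff sum.infinite)
qed

lemma gcoeff_times_assoc:
  fixes f g h :: "'a grassmann"
  assumes C: "finite C"
  shows "gcoeff (f * g * h) C = gcoeff (f * (g * h)) C"
proof -
  let ?F = "\<lambda>(A, B). gsign A (C - A) * gsign B (C - A - B) *
    gcoeff f A * gcoeff g B * gcoeff h (C - A - B)"
  have fin: "finite D" if "D \<subseteq> C" for D using that C by (rule finite_subset)
  have sgn: "gsign D (C - D) * gsign A (D - A) = (gsign A (C - A) * gsign (D - A) (C - D) :: 'a)"
    if "A \<subseteq> D" "D \<subseteq> C" for A D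
  proof -
    have 1: "D = A \<union> (D - A)" "C - A = (D - A) \<union> (C - D)" using that by auto
    have "gsign D (C - D) = (gsign A (C - D) * gsign (D - A) (C - D) :: 'a)"
      by (subst 1(1), rule gsign_Un_left) (use that fin in \<open>auto intro: finite_subset\<close>)
    moreover have "gsign A (C - A) = (gsign A (D - A) * gsign A (C - D) :: 'a)"
      by (subst 1(2), rule gsign_Un_right) (use that fin in \<open>auto intro: finite_subset\<close>)
    ultimately show ?thesis by simp
  qed
  have diff: "C - A - (D - A) = C - D" if "A \<subseteq> D" for A D
    using that by blast
  have "gcoeff (f * g * h) C = (\<Sum>D\<in>Pow C. \<Sum>A\<in>Pow D. gsign D (C - D) * gsign A (D - A) *
      gcoeff f A * gcoeff g (D - A) * gcoeff h (C - D))"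
    by (simp add: times_grassmann.rep_eq sum_distrib_left sum_distrib_right mult.assoc)
  also have "\<dots> = (\<Sum>(D, A)\<in>Sigma (Pow C) Pow. gsign D (C - D) * gsign A (D - A) *
      gcoeff f A * gcoeff g (D - A) * gcoeff h (C - D))"
    by (rule sum.Sigma) (use C fin in auto)
  also have "\<dots> = (\<Sum>(D, A)\<in>Sigma (Pow C) Pow. gsign A (C - A) * gsign (D - A) (C - D) *
      gcoeff f A * gcoeff g (D - A) * gcoeff h (C - D))"
    by (rule sum.cong) (auto simp: sgn)
  also have "\<dots> = (\<Sum>p\<in>Sigma (Pow C) (\<lambda>A. Pow (C - A)). ?F p)"
    by (rule sum.reindex_bij_witness [where i = "\<lambda>(A, B). (A \<union> B, A)" and j = "\<lambda>(D, A). (A, D - A)"])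
      (auto simp: diff)
  also have "\<dots> = (\<Sum>A\<in>Pow C. \<Sum>B\<in>Pow (C - A). ?F (A, B))"
    by (subst sum.Sigma) (use C in auto)
  also have "\<dots> = gcoeff (f * (g * h)) C"
    by (simp add: times_grassmann.rep_eq sum_distrib_left mult_ac)
  finally show ?thesis .
qed

instance
proof
  fix f g h :: "'a grassmann"
  show "f + g + h = f + (g + h)" by transfer (simp add: add.assoc)
  show "f + g = g + f" by transfer (simp add: add.commute)
  show "0 + f = f" by transfer simp
  show "- f + f = 0" by transfer simp
  show "f - g = f + - g" by (simp add: minus_grassmann_def)
  show "(f + g) * h = f * h + g * h"
    by transfer (simp add: algebra_simps sum.distrib)
  show "f * (g + h) = f * g + f * h"
    by transfer (simp add: algebra_simps sum.distrib)
  show "f * g * h = f * (g * h)"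
    by (rule grassmann_eqI) (metis gcoeff_infinite gcoeff_times_assoc)
  show "1 * f = f"
  proof (rule grassmann_eqI)
    fix C
    show "gcoeff (1 * f) C = gcoeff f C"
    proof (cases "finite C")
      case True
      have "gcoeff (1 * f) C = (\<Sum>A\<in>Pow C. if A = {} then gcoeff f C else 0)"
        unfolding times_grassmann.rep_eq one_grassmann.rep_eq by (rule sum.cong) auto
      then show ?thesis using True by simp
    qed (simp add: gcoeff_infinite)
  qed
  show "f * 1 = f"
  proof (rule grassmann_eqI)
    fix C
    show "gcoeff (f * 1) C = gcoeff f C"
    proof (cases "finite C")
      case True
      have "gcoeff (f * 1) C = (\<Sum>A\<in>Pow C. if A = C then gcoeff f C else 0)"
        unfolding times_grassmann.rep_eq one_grassmann.rep_eq by (rule sum.cong) auto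
      then show ?thesis using True by simp
    qed (simp add: gcoeff_infinite)
  qed
  show "(0 :: 'a grassmann) \<noteq> 1" by transfer (metis zero_neq_one)
qed

end

lift_definition gscale :: "'k::field \<Rightarrow> 'k grassmann \<Rightarrow> 'k grassmann"
  is "\<lambda>c f A. c * f A"
  by (auto elim: rev_finite_subset)

interpretation grassmann: vector_space gscale
  by standard (transfer, simp add: algebra_simps)+

lemma gscale_mult_left: "gscale c f * g = gscale c (f * g)"
  by transfer (simp add: sum_distrib_left mult_ac)

lemma gscale_mult_right: "f * gscale c g = gscale c (f * g)"
  by transfer (simp add: sum_distrib_left mult_ac)

lift_definition gen :: "nat \<Rightarrow> 'k::field grassmann" is "\<lambda>i A. if A = {i} then 1 else 0"
  by simp

text \<open>The defining relations, and the basis of ordered monomials (including the empty one).\<close>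

lemma gcoeff_gen_mult:
  "gcoeff (gen i * f) C = (if finite C \<and> i \<in> C then gsign {i} (C - {i}) * gcoeff f (C - {i}) else 0)"
proof (cases "finite C")
  case True
  have "gcoeff (gen i * f) C =
      (\<Sum>A\<in>Pow C. if A = {i} then gsign {i} (C - {i}) * gcoeff f (C - {i}) else 0)"
    unfolding times_grassmann.rep_eq gen.rep_eq by (rule sum.cong) auto
  then show ?thesis using True by simp
qed (simp add: gcoeff_infinite)

lemma gen_square: "gen i * gen i = 0"
  by (rule grassmann_eqI) (auto simp: gcoeff_gen_mult gen.rep_eq zero_grassmann.rep_eq)

lemma gsign_singletons: "gsign {i} {j} = (if j < i then - 1 else 1)"
proof -
  have "{(a, b). a \<in> {i} \<and> b \<in> {j} \<and> b < a} = (if j < i then {(i, j)} else {})" by auto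
  then show ?thesis by (simp add: gsign_def)
qed

lemma gen_anticommute: "gen i * gen j = - (gen j * gen i)"
proof (cases "i = j")
  case False
  show ?thesis
  proof (rule grassmann_eqI)
    fix C
    have *: "C - {i} = {j} \<and> i \<in> C \<longleftrightarrow> C = {i, j}" "C - {j} = {i} \<and> j \<in> C \<longleftrightarrow> C = {i, j}"
      using False by auto
    show "gcoeff (gen i * gen j :: 'a grassmann) C = gcoeff (- (gen j * gen i)) C"
    proof (cases "C = {i, j}")
      case True
      moreover have "{i, j} - {i} = {j}" "{i, j} - {j} = {i}" using False by auto
      ultimately show ?thesis using False
        by (simp add: gcoeff_gen_mult gen.rep_eq uminus_grassmann.rep_eq gsign_singletons)
    next
      case False
      then show ?thesis
        using * by (auto simp: gcoeff_gen_mult gen.rep_eq uminus_grassmann.rep_eq)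
    qed
  qed
qed (simp add: gen_square)

lemma gcoeff_monomial:
  assumes "sorted_wrt (<) ns"
  shows "gcoeff (prod_list (map gen ns)) B = (if B = set ns then 1 else 0)"
  using assms
proof (induction ns arbitrary: B)
  case Nil
  then show ?case by (simp add: one_grassmann.rep_eq)
next
  case (Cons i js)
  then have lt: "\<forall>j\<in>set js. i < j" by simp
  then have "{(a, b). a \<in> {i} \<and> b \<in> set js \<and> b < a} = {}" by auto
  then have "gsign {i} (set js) = (1::'a)" unfolding gsign_def by (metis card.empty power_0)
  moreover have "finite B \<and> i \<in> B \<and> B - {i} = set js \<longleftrightarrow> B = insert i (set js)"
    using lt by auto
  ultimately show ?case using Cons by (auto simp: gcoeff_gen_mult)
qed

definition gbasis :: "'k::field grassmann set"
  where "gbasis = {prod_list (map gen ns) |ns. sorted_wrt (<) ns}"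

lemma gcoeff_sum: "gcoeff (sum f I) A = (\<Sum>i\<in>I. gcoeff (f i) A)"
  by (induction I rule: infinite_finite_induct)
    (simp_all add: zero_grassmann.rep_eq plus_grassmann.rep_eq)

lemma grassmann_basis:
  "\<not> grassmann.dependent (gbasis :: 'k::field grassmann set)"
  "grassmann.span (gbasis :: 'k::field grassmann set) = UNIV"
proof -
  show "\<not> grassmann.dependent (gbasis :: 'k grassmann set)"
  proof
    assume "grassmann.dependent (gbasis :: 'k grassmann set)"
    then obtain S u b where S: "finite S" "S \<subseteq> gbasis" "(\<Sum>v\<in>S. gscale (u v) v) = 0"
      and b: "b \<in> S" "u b \<noteq> (0::'k)"
      unfolding grassmann.dependent_explicit by blast
    from b S obtain ns where bis: "b = prod_list (map gen ns)" "sorted_wrt (<) ns"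
      unfolding gbasis_def by blast
    have "gcoeff v (set ns) = (if v = b then 1 else 0)" if "v \<in> S" for v
    proof -
      from that S obtain js where js: "v = prod_list (map gen js)" "sorted_wrt (<) js"
        unfolding gbasis_def by blast
      show ?thesis
      proof (cases "v = b")
        case True
        then show ?thesis using bis by (simp add: gcoeff_monomial)
      next
        case False
        then have "set ns \<noteq> set js" using bis js by (metis strict_sorted_equal)
        then show ?thesis using False js by (simp add: gcoeff_monomial)
      qed
    qed
    then have "gcoeff (\<Sum>v\<in>S. gscale (u v) v) (set ns) = (\<Sum>v\<in>S. if v = b then u b else 0)"
      unfolding gcoeff_sum gscale.rep_eq by (intro sum.cong) auto
    with S b show False by (simp add: zero_grassmann.rep_eq)
  qed
  show "grassmann.span (gbasis :: 'k grassmann set) = UNIV"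
  proof (rule UNIV_eq_I [symmetric])
    fix f :: "'k grassmann"
    let ?m = "\<lambda>A. prod_list (map gen (sorted_list_of_set A)) :: 'k grassmann"
    let ?S = "{A. gcoeff f A \<noteq> 0}"
    have m: "gcoeff (?m A) B = (if B = A then 1 else 0)" if "A \<in> ?S" for A B
    proof -
      from that have "finite A" using gcoeff_infinite [of A f] by blast
      then show ?thesis by (simp add: gcoeff_monomial)
    qed
    have "f = (\<Sum>A\<in>?S. gscale (gcoeff f A) (?m A))"
    proof (rule grassmann_eqI)
      fix B
      have "gcoeff (\<Sum>A\<in>?S. gscale (gcoeff f A) (?m A)) B = (\<Sum>A\<in>?S. if B = A then gcoeff f B else 0)"
        unfolding gcoeff_sum gscale.rep_eq by (intro sum.cong) (auto simp: m)
      also have "\<dots> = gcoeff f B" using finite_gsupp [of f] by simp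
      finally show "gcoeff f B = gcoeff (\<Sum>A\<in>?S. gscale (gcoeff f A) (?m A)) B" by simp
    qed
    also have "\<dots> \<in> grassmann.span gbasis"
      by (intro grassmann.span_sum grassmann.span_scale grassmann.span_base)
        (auto simp: gbasis_def)
    finally show "f \<in> grassmann.span gbasis" .
  qed
qed


section \<open>T-spaces and central polynomials\<close>

definition alg_hom ::
    "('k::field \<Rightarrow> 'a::ring_1 \<Rightarrow> 'a) \<Rightarrow> ('k \<Rightarrow> 'b::ring_1 \<Rightarrow> 'b) \<Rightarrow> ('a \<Rightarrow> 'b) \<Rightarrow> bool"
  where "alg_hom s1 s2 \<phi> \<longleftrightarrow> Vector_Spaces.linear s1 s2 \<phi> \<and>
    \<phi> 1 = 1 \<and> (\<forall>a b. \<phi> (a * b) = \<phi> a * \<phi> b)"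

definition T_space :: "'k::field free_alg set \<Rightarrow> bool"
  where "T_space V \<longleftrightarrow> free_alg.subspace V \<and>
    (\<forall>\<phi>. alg_hom fscale fscale \<phi> \<longrightarrow> \<phi> ` V \<subseteq> V)"

definition T_space_gen :: "'k::field free_alg set \<Rightarrow> 'k free_alg set"
  where "T_space_gen B = T_space hull B"

lemma T_space_T_space_gen: "T_space (T_space_gen B)"
  unfolding T_space_gen_def
proof (rule hull_in)
  fix T :: "'a free_alg set set"
  assume "\<forall>V\<in>T. T_space V"
  then show "T_space (\<Inter>T)"
    unfolding T_space_def by (auto intro!: free_alg.subspace_Inter) blast
qed

definition TG :: "'k::field free_alg set"
  where "TG = {f. \<forall>\<phi> :: 'k free_alg \<Rightarrow> 'k grassmann. alg_hom fscale gscale \<phi> \<longrightarrow> \<phi> f = 0}"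

definition centre :: "'a::ring_1 set"
  where "centre = {z. \<forall>a. z * a = a * z}"

definition central_polynomial :: "'k::field free_alg \<Rightarrow> bool"
  where "central_polynomial f \<longleftrightarrow> f \<notin> TG \<and>
    (\<forall>\<phi> :: 'k free_alg \<Rightarrow> 'k grassmann. alg_hom fscale gscale \<phi> \<longrightarrow> \<phi> f \<in> centre)"

definition CPG :: "'k::field free_alg set"
  where "CPG = T_space_gen {f. central_polynomial f}"

text \<open>The sum of the two T-spaces is the elementwise sum of sets from \<open>Set_Algebras\<close>; the product
  over \<open>i = 1, \<dots>, t\<close> is taken from left to right.\<close>

definition S1 :: "nat \<Rightarrow> 'k::field free_alg set"
  where "S1 p = T_space_gen {commutator (X 1) (X 2), X 1 ^ p} +
    T_space_gen {X 1 ^ p * (\<Prod>i\<leftarrow>[1..<t + 1]. commutator (X (2 * i)) (X (2 * i + 1)) *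
      X (2 * i) ^ (p - 1) * X (2 * i + 1) ^ (p - 1)) |t. t \<ge> 1}"

end

theory Submission
  imports Defs "HOL-Number_Theory.Residues"
begin

text \<open>
  The central polynomials span the space of all polynomials \<open>f\<close> with central values on \<open>G\<close>, and
  the centre of \<open>G\<close> is its even part. For such an \<open>f\<close> and a variable \<open>x\<^sub>i\<close>, collecting letters and using
  that commutators are central in \<open>G\<close>, the linear part of \<open>f(x\<^sub>i + s)\<close> in \<open>s\<close> can be written as
  \<open>A s + \<Sum> B\<^sub>l [s, x\<^sub>l]\<close> modulo \<open>T(G)\<close>. If \<open>s\<close> is a product of two fresh generators of \<open>G\<close>, or a single one, this
  value is central because \<open>s g s = 0\<close> for all \<open>g\<close>; this yields \<open>A = \<Sum> [B\<^sub>l, x\<^sub>l]\<close> modulo \<open>T(G)\<close>. With \<open>s = x\<^sub>i\<close>, the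
  degree operator of \<open>x\<^sub>i\<close> maps \<open>f\<close> to \<open>\<Sum> [B\<^sub>l x\<^sub>i, x\<^sub>l]\<close>, a sum of commutators. By Fermat's little theorem
  its \<open>(p - 1)\<close>-st power annihilates the words whose degree in \<open>x\<^sub>i\<close> is divisible by \<open>p\<close> and fixes the
  others, so \<open>f\<close> is congruent to a combination of words whose degrees are all divisible by \<open>p\<close>.

  Such a word can be reordered at the price of products \<open>w [a\<^sub>1, b\<^sub>1] \<dots> [a\<^sub>s, b\<^sub>s]\<close> with shorter \<open>w\<close>. These lie in
  \<open>T(G)\<close> unless the \<open>a\<^sub>j, b\<^sub>j\<close> are distinct, and then \<open>w\<close> is a rearrangement of
  \<open>M\<^sup>p \<Prod> a\<^sub>j\<^bsup>p-1\<^esup> b\<^sub>j\<^bsup>p-1\<^esup>\<close>, which gives a substitution instance of a generator.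
\<close>

section \<open>The grading of the Grassmann algebra\<close>

definition geven :: "'k::field grassmann \<Rightarrow> bool"
  where "geven f \<longleftrightarrow> (\<forall>A. gcoeff f A \<noteq> 0 \<longrightarrow> even (card A))"

definition godd :: "'k::field grassmann \<Rightarrow> bool"
  where "godd f \<longleftrightarrow> (\<forall>A. gcoeff f A \<noteq> 0 \<longrightarrow> odd (card A))"

lift_definition even_part :: "'k::field grassmann \<Rightarrow> 'k grassmann"
  is "\<lambda>f A. if even (card A) then f A else 0"
  by (auto elim: rev_finite_subset)

lift_definition odd_part :: "'k::field grassmann \<Rightarrow> 'k grassmann"
  is "\<lambda>f A. if odd (card A) then f A else 0"
  by (auto elim: rev_finite_subset)

lemma even_odd_decomp: "f = even_part f + odd_part f"
  by (rule grassmann_eqI) (simp add: even_part.rep_eq odd_part.rep_eq plus_grassmann.rep_eq)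

lemma geven_even_part [simp]: "geven (even_part f)"
  by (simp add: geven_def even_part.rep_eq)

lemma godd_odd_part [simp]: "godd (odd_part f)"
  by (simp add: godd_def odd_part.rep_eq)

lemma geven_add [intro]: "geven f \<Longrightarrow> geven g \<Longrightarrow> geven (f + g)"
  unfolding geven_def plus_grassmann.rep_eq by (metis add.right_neutral)

lemma geven_uminus [intro]: "geven f \<Longrightarrow> geven (- f)"
  by (simp add: geven_def uminus_grassmann.rep_eq)

lemma geven_diff [intro]: "geven f \<Longrightarrow> geven g \<Longrightarrow> geven (f - g)"
  unfolding diff_conv_add_uminus by blast

lemma geven_0 [simp]: "geven 0"
  by (simp add: geven_def zero_grassmann.rep_eq)

lemma geven_1 [simp]: "geven 1"
  by (simp add: geven_def one_grassmann.rep_eq)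

lemma godd_gen [simp]: "godd (gen i)"
  by (simp add: godd_def gen.rep_eq)

lemma geven_godd_imp_0: "geven f \<Longrightarrow> godd f \<Longrightarrow> f = 0"
  by (rule grassmann_eqI) (auto simp: geven_def godd_def zero_grassmann.rep_eq)

lemma gcoeff_times_nonzeroE:
  assumes "gcoeff (f * g) C \<noteq> 0"
  obtains A B where "gcoeff f A \<noteq> 0" "gcoeff g B \<noteq> 0" "card C = card A + card B"
proof -
  from assms have "finite C" using gcoeff_infinite by blast
  from assms obtain A where A: "A \<subseteq> C" "gcoeff f A \<noteq> 0" "gcoeff g (C - A) \<noteq> 0"
    unfolding times_grassmann.rep_eq by (auto elim: sum.not_neutral_contains_not_neutral)
  have "card C = card A + card (C - A)"
    using \<open>finite C\<close> A(1) by (metis card_Diff_subset card_mono finite_subset le_add_diff_inverse)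
  with A that show ?thesis by blast
qed

lemma geven_times [intro]: "geven f \<Longrightarrow> geven g \<Longrightarrow> geven (f * g)"
  and geven_times_odd [intro]: "godd f \<Longrightarrow> godd g \<Longrightarrow> geven (f * g)"
  and godd_times_left [intro]: "godd f \<Longrightarrow> geven g \<Longrightarrow> godd (f * g)"
  and godd_times_right [intro]: "geven f \<Longrightarrow> godd g \<Longrightarrow> godd (f * g)"
  unfolding geven_def godd_def by (auto elim!: gcoeff_times_nonzeroE)

lemma geven_power [intro]: "geven f \<Longrightarrow> geven (f ^ n)"
  by (induction n) auto

section \<open>Reordering signs and supercommutativity\<close>

lemma gsign_square: "gsign A B * gsign A B = (1 :: 'k::field)"
  by (simp add: gsign_def flip: power_mult_distrib)

text \<open>For disjoint \<open>A\<close> and \<open>B\<close>, each pair in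
  \<open>A \<times> B\<close> is an inversion in exactly one of the two orders, so the two inversion
  counts add up to \<open>card A * card B\<close>.\<close>

lemma gsign_swap:
  assumes "finite A" "finite B" "A \<inter> B = {}"
  shows "gsign A B = (- 1) ^ (card A * card B) * (gsign B A :: 'k::field)"
proof -
  let ?I = "{(a, b). a \<in> A \<and> b \<in> B \<and> b < a}" and ?J = "{(b, a). b \<in> B \<and> a \<in> A \<and> a < b}"
  have "card (A \<times> B) = card (?I \<union> prod.swap ` ?J)"
    by (rule arg_cong [of _ _ card]) (use assms(3) in \<open>fastforce simp: image_iff\<close>)
  also have "\<dots> = card ?I + card (prod.swap ` ?J)"
    by (rule card_Un_disjoint) (use assms in \<open>auto intro: finite_inversions\<close>)
  also have "card (prod.swap ` ?J) = card ?J"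
    by (rule card_image) (auto simp: inj_on_def)
  finally have "(- 1) ^ (card A * card B) = gsign A B * (gsign B A :: 'k)"
    by (simp add: gsign_def card_cartesian_product flip: power_add)
  then show ?thesis by (simp add: mult.assoc gsign_square)
qed

text \<open>Replacing \<open>A\<close> by \<open>C - A\<close> in the convolution interchanges the
  factors. Keeping the sign \<open>c\<close> as a parameter serves an even factor
  (\<open>c = 1\<close>) and two odd factors (\<open>c = - 1\<close>) alike.\<close>

lemma gcoeff_times_swap:
  fixes f g :: "'k::field grassmann"
  assumes "\<And>A B. A \<inter> B = {} \<Longrightarrow> gcoeff f A \<noteq> 0 \<Longrightarrow> gcoeff g B \<noteq> 0 \<Longrightarrow>
    (- 1) ^ (card A * card B) = c"
  shows "gcoeff (f * g) C = c * gcoeff (g * f) C"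
proof (cases "finite C")
  case True
  have "gcoeff (f * g) C = (\<Sum>A\<in>Pow C. gsign (C - A) A * gcoeff f (C - A) * gcoeff g A)"
    unfolding times_grassmann.rep_eq
    by (rule sum.reindex_bij_witness [where i = "\<lambda>A. C - A" and j = "\<lambda>A. C - A"])
      (auto simp: double_diff)
  also have "\<dots> = (\<Sum>A\<in>Pow C. c * (gsign A (C - A) * gcoeff g A * gcoeff f (C - A)))"
  proof (rule sum.cong)
    fix A assume "A \<in> Pow C"
    then have fin: "finite A" "finite (C - A)" using True by (auto intro: finite_subset)
    show "gsign (C - A) A * gcoeff f (C - A) * gcoeff g A =
        c * (gsign A (C - A) * gcoeff g A * gcoeff f (C - A))"
    proof (cases "gcoeff f (C - A) = 0 \<or> gcoeff g A = 0")
      case False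
      then have "(- 1) ^ (card (C - A) * card A) = c" by (intro assms) auto
      then show ?thesis using gsign_swap [OF fin(2,1), where 'k = 'k] by auto
    qed auto
  qed simp
  finally show ?thesis by (simp add: times_grassmann.rep_eq sum_distrib_left)
qed (simp add: gcoeff_infinite)

lemma geven_commute: "geven f \<Longrightarrow> f * g = g * f"
  by (rule grassmann_eqI, subst gcoeff_times_swap [where c = 1]) (auto simp: geven_def)

lemma godd_anticommute: "godd f \<Longrightarrow> godd g \<Longrightarrow> f * g = - (g * f)"
  by (rule grassmann_eqI, subst gcoeff_times_swap [where c = "- 1"])
    (auto simp: godd_def uminus_grassmann.rep_eq)

section \<open>Fresh generators, annihilators and the centre\<close>

lemma obtain_fresh:
  obtains i where "\<And>A. gcoeff f A \<noteq> 0 \<Longrightarrow> i \<notin> A"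
proof -
  have "finite (\<Union>{A. gcoeff f A \<noteq> 0})"
    using finite_gsupp gcoeff_infinite by (intro finite_Union) auto
  then obtain i where "i \<notin> \<Union>{A. gcoeff f A \<noteq> 0}"
    using ex_new_if_finite infinite_UNIV_nat by blast
  then show ?thesis using that by blast
qed

text \<open>A generator outside the support sends distinct basis elements, up to sign, to distinct
  basis elements, so nothing cancels.\<close>

lemma gen_times_eq_0:
  assumes "\<And>A. gcoeff f A \<noteq> 0 \<Longrightarrow> i \<notin> A" and "gen i * f = 0"
  shows "f = 0"
proof (rule grassmann_eqI, rule ccontr)
  fix A assume "gcoeff f A \<noteq> gcoeff 0 A"
  then have *: "gcoeff f A \<noteq> 0" by (simp add: zero_grassmann.rep_eq)
  then have "finite A" "i \<notin> A" using gcoeff_infinite assms(1) by blast+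
  then have "gcoeff (gen i * f) (insert i A) = gsign {i} A * gcoeff f A"
    by (simp add: gcoeff_gen_mult)
  moreover have "gsign {i} A \<noteq> (0::'a)" by (simp add: gsign_def)
  ultimately show False using * assms(2) by (simp add: zero_grassmann.rep_eq)
qed

text \<open>Here the infinite supply of generators matters: one of them is absent from the finite
  support of \<open>f\<close>.\<close>

lemma eq_0_if_gen_times_eq_0: "(\<And>i. gen i * f = 0) \<Longrightarrow> f = 0"
  by (metis obtain_fresh gen_times_eq_0)

lemma double_eq_gscale: "f + f = gscale 2 f"
  by (rule grassmann_eqI) (simp add: plus_grassmann.rep_eq gscale.rep_eq)

lemma double_eq_0_grassmann:
  fixes f :: "'k::field grassmann"
  assumes "(2 :: 'k) \<noteq> 0" "f + f = 0"
  shows "f = 0"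
  using assms by (metis double_eq_gscale grassmann.scale_eq_0_iff)

context
  assumes two: "(2 :: 'k::field) \<noteq> 0"
begin

lemma godd_square: "godd f \<Longrightarrow> f * f = (0 :: 'k grassmann)"
  using godd_anticommute [of f f] double_eq_0_grassmann [OF two, of "f * f"]
  by (simp add: eq_neg_iff_add_eq_0)

text \<open>The even part of \<open>g\<close> commutes with \<open>f\<close> and the odd part
  anticommutes; either way \<open>f * f = 0\<close> appears.\<close>

lemma godd_sandwich:
  assumes "godd f"
  shows "f * g * f = (0 :: 'k grassmann)"
proof -
  have "f * even_part g * f = even_part g * (f * f)"
    by (metis geven_commute geven_even_part mult.assoc)
  moreover have "f * odd_part g * f = - (odd_part g * (f * f))"
    using godd_anticommute [OF assms godd_odd_part, of g] by (simp add: mult.assoc)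
  ultimately have "f * (even_part g + odd_part g) * f = 0"
    by (simp add: distrib_left distrib_right godd_square assms)
  then show ?thesis by (simp flip: even_odd_decomp)
qed

text \<open>A central element commutes with \<open>gen i\<close>, while its odd part anticommutes
  with it; hence every generator kills the odd part.\<close>

lemma mem_centre_iff: "z \<in> centre \<longleftrightarrow> geven (z :: 'k grassmann)"
proof
  assume z: "z \<in> centre"
  have "gen i * odd_part z = 0" for i
  proof (rule double_eq_0_grassmann [OF two])
    let ?a = "even_part z" and ?b = "odd_part z"
    have "(?a + ?b) * gen i = gen i * (?a + ?b)"
      using z by (simp add: centre_def flip: even_odd_decomp)
    moreover have "?a * gen i = gen i * ?a" by (rule geven_commute) simp
    moreover have "?b * gen i = - (gen i * ?b)" by (rule godd_anticommute) simp_all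
    ultimately have "gen i * ?b = - (gen i * ?b)"
      by (simp add: distrib_left distrib_right)
    then show "gen i * ?b + gen i * ?b = 0" by (simp only: eq_neg_iff_add_eq_0)
  qed
  then have "odd_part z = 0" by (rule eq_0_if_gen_times_eq_0)
  then have "z = even_part z" using even_odd_decomp [of z] by simp
  then show "geven z" by (metis geven_even_part)
qed (auto simp: centre_def geven_commute)

end

section \<open>Commutators and powers in the Grassmann algebra\<close>

lemma commutator_grassmann:
  "commutator a b = odd_part a * odd_part b + odd_part a * (odd_part b :: 'k::field grassmann)"
proof -
  have "a * b - b * a = (even_part a + odd_part a) * (even_part b + odd_part b) -
      (even_part b + odd_part b) * (even_part a + odd_part a)"
    by (simp flip: even_odd_decomp)
  also have "\<dots> = odd_part a * odd_part b - odd_part b * odd_part a"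
    using geven_commute [of "even_part a" "even_part b"]
      geven_commute [of "even_part a" "odd_part b"] geven_commute [of "even_part b" "odd_part a"]
    by (simp add: distrib_left distrib_right)
  finally show ?thesis
    using godd_anticommute [of "odd_part b" "odd_part a"] by (simp add: commutator_def)
qed

lemma geven_commutator [simp]: "geven (commutator a b)"
  unfolding commutator_grassmann by (intro geven_add geven_times_odd) auto


lemma commutator_times_power:
  assumes "geven c" and "c * odd_part a = 0"
  shows "c * a ^ n = c * even_part a ^ n"
proof (induction n)
  case (Suc n)
  have "c * a ^ Suc n = c * a ^ n * a" by (simp only: power_Suc2 mult.assoc)
  also have "\<dots> = even_part a ^ n * (c * a)"
    using geven_commute [OF \<open>geven c\<close>, of "even_part a ^ n"] by (simp add: Suc mult.assoc)
  also have "c * a = c * even_part a"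
    using arg_cong [OF even_odd_decomp [of a], of "(*) c"] assms(2) by (simp add: distrib_left)
  also have "even_part a ^ n * (c * even_part a) = c * even_part a ^ Suc n"
    using geven_commute [OF \<open>geven c\<close>, of "even_part a ^ n"]
    by (metis mult.assoc power_Suc2)
  finally show ?case .
qed simp

text \<open>The binomial expansion stops after the term linear in \<open>b\<close>.\<close>

lemma sum_power_if_square_0:
  fixes a b :: "'a::ring_1"
  assumes "a * b = b * a" and "b * b = 0"
  shows "(a + b) ^ Suc n = a ^ Suc n + of_nat (Suc n) * (a ^ n * b)"
proof (induction n)
  case (Suc n)
  have "(a + b) ^ Suc (Suc n) = (a ^ Suc n + of_nat (Suc n) * (a ^ n * b)) * (a + b)"
    by (simp only: power_Suc2 [of _ "Suc n"] Suc)
  also have "\<dots> = a ^ Suc n * a + a ^ Suc n * b + of_nat (Suc n) * (a ^ n * (b * a))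
      + of_nat (Suc n) * (a ^ n * (b * b))"
    by (simp only: distrib_left distrib_right mult.assoc add_ac)
  also have "\<dots> = a ^ Suc (Suc n) + of_nat (Suc (Suc n)) * (a ^ Suc n * b)"
    unfolding assms(2) assms(1) [symmetric] power_Suc2 [of a]
    by (simp add: distrib_right mult.assoc)
  finally show ?case .
qed simp

lemma of_nat_grassmann: "of_nat n = gscale (of_nat n) (1 :: 'k::field grassmann)"
  by (induction n) (simp_all add: grassmann.scale_left_distrib)

context
  assumes two: "(2 :: 'k::field) \<noteq> 0"
begin

text \<open>The odd part squares to zero, so the only odd contribution to the power carries the
  coefficient \<open>p\<close>, which vanishes.\<close>

lemma geven_power_CHAR:
  assumes "CHAR('k) = p" "p > 0"
  shows "geven ((a :: 'k grassmann) ^ p)"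
proof -
  obtain n where n: "p = Suc n" using assms(2) gr0_implies_Suc by blast
  have "(even_part a + odd_part a) ^ p = even_part a ^ p + of_nat p * (even_part a ^ n * odd_part a)"
    unfolding n
    by (rule sum_power_if_square_0 [OF geven_commute godd_square [OF two]]) simp_all
  moreover have "of_nat p = (0 :: 'k grassmann)"
    using assms(1) of_nat_CHAR [where 'a = 'k] by (simp add: of_nat_grassmann)
  ultimately have "a ^ p = even_part a ^ p" by (simp flip: even_odd_decomp)
  then show ?thesis by (metis geven_even_part geven_power)
qed

text \<open>The commutator is twice the product of the odd parts of \<open>a\<close> and
  \<open>b\<close>, so it annihilates both; next to it the powers depend on the even parts
  only.\<close>

lemma geven_commutator_powers: "geven (commutator a b * a ^ m * b ^ n :: 'k grassmann)"
proof -
  have a: "commutator a b * odd_part a = 0" and b: "commutator a b * odd_part b = 0"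
    using godd_sandwich [OF two godd_odd_part, of a "odd_part b"] godd_square [OF two, of "odd_part b"]
    by (simp_all add: commutator_grassmann distrib_right mult.assoc)
  let ?c = "commutator a b * even_part a ^ m"
  have c: "geven ?c" by (intro geven_times geven_power) simp_all
  have "?c = even_part a ^ m * commutator a b" by (rule geven_commute) simp
  then have "?c * odd_part b = 0" using b by (simp add: mult.assoc)
  then have "?c * b ^ n = ?c * even_part b ^ n" by (rule commutator_times_power [OF c])
  moreover have "commutator a b * a ^ m = ?c"
    by (rule commutator_times_power [OF geven_commutator a])
  ultimately have "commutator a b * a ^ m * b ^ n = ?c * even_part b ^ n" by simp
  then show ?thesis using c by (metis geven_even_part geven_power geven_times)
qed

lemma prod_list_odd_eq_0:
  assumes "\<And>i. godd (v i :: 'k grassmann)" and "\<not> distinct is"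
  shows "prod_list (map v is) = 0"
proof -
  from assms(2) obtain xs ys zs x where "is = xs @ [x] @ ys @ [x] @ zs"
    using not_distinct_decomp by blast
  moreover have "v x * (prod_list (map v ys) * (v x * g)) = 0" for g
    using godd_sandwich [OF two assms(1), of x "prod_list (map v ys)"] by (simp flip: mult.assoc)
  ultimately show ?thesis by (simp add: mult.assoc)
qed

text \<open>Modulo the even part, commuting with the fixed element \<open>b\<close> can be shifted from the odd
  element \<open>s\<close> to the coefficient \<open>a\<close>.\<close>

lemma geven_commutator_shift:
  assumes "godd (s :: 'k grassmann)"
  shows "geven (a * commutator s b + commutator a b * s)"
proof -
  have s: "odd_part s = s" "even_part s = 0"
    using assms by (auto intro!: grassmann_eqI simp: godd_def odd_part.rep_eq even_part.rep_eq
        zero_grassmann.rep_eq)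
  let ?c = "commutator s b"
  have "a * ?c = even_part a * ?c + odd_part a * ?c"
    using arg_cong [OF even_odd_decomp [of a], of "\<lambda>x. x * ?c"] by (simp only: distrib_right)
  also have "odd_part a * ?c = - (commutator a b * s)"
    using godd_anticommute [OF assms, of "odd_part b"]
    by (simp add: commutator_grassmann s distrib_left distrib_right right_diff_distrib mult.assoc)
  finally have "a * ?c + commutator a b * s = even_part a * ?c" by simp
  then show ?thesis by (metis geven_commutator geven_even_part geven_times)
qed

end

text \<open>Makes \<open>prod_list_odd_eq_0\<close> applicable to products of commutators: a letter
  repeated in the flattened list kills the whole product.\<close>

lemma prod_list_commutators:
  "(\<Prod>(a, b)\<leftarrow>L. commutator (v a) (v b)) =
    of_nat (2 ^ length L) * prod_list (map (\<lambda>i. odd_part (v i)) (concat (map (\<lambda>(a, b). [a, b]) L)))"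
proof (induction L)
  case (Cons x L)
  obtain a b where x: "x = (a, b)" by fastforce
  let ?P = "prod_list (map (\<lambda>i. odd_part (v i)) (concat (map (\<lambda>(a, b). [a, b]) L)))"
  have "(\<Prod>(a, b)\<leftarrow>x # L. commutator (v a) (v b)) =
      2 * (odd_part (v a) * odd_part (v b)) * (of_nat (2 ^ length L) * ?P)"
    by (simp only: x list.map prod_list.Cons prod.case Cons)
      (simp only: commutator_grassmann mult_2 distrib_right)
  also have "\<dots> = 2 * (of_nat (2 ^ length L) * (odd_part (v a) * odd_part (v b)) * ?P)"
    using mult_of_nat_commute [of "2 ^ length L" "odd_part (v a) * odd_part (v b)"]
    by (simp add: mult.assoc flip: mult.assoc [of _ "of_nat _"])
  finally show ?case by (simp add: x mult.assoc)
qed simp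

section \<open>Homomorphisms from the free algebra\<close>

primrec letters :: "'x free_monoid \<Rightarrow> 'x list"
  where "letters (Free_Monoid w) = w"

definition word :: "nat list \<Rightarrow> 'k::field free_alg"
  where "word w = Poly_Mapping.single (Free_Monoid w) 1"

lemma word_Nil [simp]: "word [] = 1"
  by (simp add: word_def flip: zero_free_monoid_def)

lemma word_append: "word (u @ w) = word u * word w"
  by (simp add: word_def mult_single)

lemma word_Cons: "word (c # w) = word [c] * word w"
  using word_append [of "[c]" w] by simp

lemma X_Suc: "X (Suc n) = word [n]"
  by (simp add: X_def word_def)

lemma fscale_mult_left: "fscale c f * g = fscale c (f * g)"
  by (simp add: fscale_eq_mult mult.assoc)

text \<open>The scalar \<open>single 0 c\<close> is central although the free algebra is not
  commutative; this is checked word by word.\<close>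

lemma fscale_mult_right: "f * fscale c g = fscale c (f * g)"
proof -
  have "f * Poly_Mapping.single 0 c = Poly_Mapping.single 0 c * f"
  proof -
    have "f = (\<Sum>m\<in>Poly_Mapping.keys f. Poly_Mapping.single m (Poly_Mapping.lookup f m))"
      by (rule poly_mapping_eqI) (simp add: lookup_sum lookup_single when_def in_keys_iff)
    moreover have "(\<Sum>m\<in>M. Poly_Mapping.single m (Poly_Mapping.lookup f m)) * Poly_Mapping.single 0 c =
        Poly_Mapping.single 0 c * (\<Sum>m\<in>M. Poly_Mapping.single m (Poly_Mapping.lookup f m))" for M
      by (simp add: sum_distrib_left sum_distrib_right mult_single mult.commute)
    ultimately show ?thesis by metis
  qed
  then show ?thesis by (simp add: fscale_eq_mult flip: mult.assoc)
qed

lemma single_eq_fscale_word: "Poly_Mapping.single m c = fscale c (word (letters m))"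
  by (cases m; rule poly_mapping_eqI) (simp add: word_def lookup_single when_def)

lemma free_alg_induct [case_names zero word add]:
  assumes "P 0" and "\<And>c w. P (fscale c (word w))" and "\<And>f g. P f \<Longrightarrow> P g \<Longrightarrow> P (f + g)"
  shows "P f"
proof -
  have "P (\<Sum>m\<in>M. Poly_Mapping.single m (Poly_Mapping.lookup f m))" if "finite M" for M
    using that by induction (auto intro: assms simp: single_eq_fscale_word)
  moreover have "f = (\<Sum>m\<in>Poly_Mapping.keys f. Poly_Mapping.single m (Poly_Mapping.lookup f m))"
    by (rule poly_mapping_eqI) (simp add: lookup_sum lookup_single when_def in_keys_iff)
  ultimately show ?thesis by (metis finite_keys)
qed

section \<open>Linear extension from words and evaluation homomorphisms\<close>

locale scaled_algebra = vector_space sc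
  for sc :: "'k::field \<Rightarrow> 'a::ring_1 \<Rightarrow> 'a" +
  assumes sc_mult_left: "sc c a * b = sc c (a * b)" and sc_mult_right: "a * sc c b = sc c (a * b)"
begin

definition lin :: "(nat list \<Rightarrow> 'a) \<Rightarrow> 'k free_alg \<Rightarrow> 'a"
  where "lin h f = (\<Sum>m\<in>Poly_Mapping.keys f. sc (Poly_Mapping.lookup f m) (h (letters m)))"

lemma lin_superset:
  "finite M \<Longrightarrow> Poly_Mapping.keys f \<subseteq> M \<Longrightarrow>
    lin h f = (\<Sum>m\<in>M. sc (Poly_Mapping.lookup f m) (h (letters m)))"
  unfolding lin_def by (rule sum.mono_neutral_left) (auto simp: in_keys_iff)

lemma lin_0 [simp]: "lin h 0 = 0"
  by (simp add: lin_def)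

lemma lin_add: "lin h (f + g) = lin h f + lin h g"
proof -
  let ?M = "Poly_Mapping.keys f \<union> Poly_Mapping.keys g"
  have "Poly_Mapping.keys (f + g) \<subseteq> ?M" by (rule Poly_Mapping.keys_add)
  then show ?thesis
    by (simp add: lin_superset [where M = ?M] lookup_add scale_left_distrib sum.distrib)
qed

lemma lin_fscale: "lin h (fscale c f) = sc c (lin h f)"
proof -
  have "Poly_Mapping.keys (fscale c f) \<subseteq> Poly_Mapping.keys f" by (auto simp: in_keys_iff)
  then show ?thesis
    by (simp add: lin_superset [where M = "Poly_Mapping.keys f"] scale_sum_right)
qed

lemma lin_word: "lin h (word w) = h w"
  by (simp add: lin_def word_def)

lemma lin_diff: "lin h (f - g) = lin h f - lin h g"
  using lin_add [of h "f - g" g] by simp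

lemma lin_plus_fun: "lin (\<lambda>w. h w + h' w) f = lin h f + lin h' f"
  by (simp add: lin_def scale_right_distrib sum.distrib)

definition hom :: "(nat \<Rightarrow> 'a) \<Rightarrow> 'k free_alg \<Rightarrow> 'a"
  where "hom v = lin (\<lambda>w. prod_list (map v w))"

lemma hom_word: "hom v (word w) = prod_list (map v w)"
  by (simp add: hom_def lin_word)

lemma hom_0 [simp]: "hom v 0 = 0"
  and hom_add: "hom v (f + g) = hom v f + hom v g"
  and hom_diff: "hom v (f - g) = hom v f - hom v g"
  and hom_fscale: "hom v (fscale c f) = sc c (hom v f)"
  by (simp_all add: hom_def lin_add lin_diff lin_fscale)

lemma hom_1 [simp]: "hom v 1 = 1"
  using hom_word [of v "[]"] by simp

lemma hom_mult: "hom v (f * g) = hom v f * hom v g"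
proof (induction f rule: free_alg_induct)
  case (word c u)
  show ?case
    by (induction g rule: free_alg_induct)
      (auto simp: fscale_mult_left fscale_mult_right hom_fscale hom_word hom_add
        sc_mult_left sc_mult_right distrib_left scale_right_distrib simp flip: word_append)
qed (simp_all add: hom_add distrib_right)

lemma hom_power: "hom v (f ^ n) = hom v f ^ n"
  by (induction n) (simp_all add: hom_mult)

lemma hom_commutator: "hom v (commutator f g) = commutator (hom v f) (hom v g)"
  by (simp add: commutator_def hom_diff hom_mult)

lemma hom_prod_list: "hom v (prod_list fs) = prod_list (map (hom v) fs)"
  by (induction fs) (simp_all add: hom_mult)

lemma hom_sum_list: "hom v (sum_list fs) = sum_list (map (hom v) fs)"
  by (induction fs) (simp_all add: hom_add)

lemma hom_X_Suc: "hom v (X (Suc n)) = v n"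
  by (simp add: X_Suc hom_word)

lemma alg_hom_hom: "alg_hom fscale sc (hom v)"
  unfolding alg_hom_def Vector_Spaces.linear_iff
  by (simp add: hom_add hom_fscale hom_mult free_alg.vector_space_axioms vector_space_axioms)

lemma alg_hom_eq_hom:
  assumes "alg_hom fscale sc \<phi>"
  shows "\<phi> = hom (\<lambda>n. \<phi> (word [n]))"
proof
  from assms have *: "\<phi> 1 = 1" "\<phi> (f * g) = \<phi> f * \<phi> g" "\<phi> (f + g) = \<phi> f + \<phi> g"
    "\<phi> (fscale c f) = sc c (\<phi> f)" for f g c
    by (simp_all add: alg_hom_def Vector_Spaces.linear_iff)
  have on_words: "\<phi> (word w) = prod_list (map (\<lambda>n. \<phi> (word [n])) w)" for w
  proof (induction w)
    case (Cons c w)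
    then show ?case by (simp add: *(2) word_Cons [of c w])
  qed (simp add: *(1))
  fix f
  show "\<phi> f = hom (\<lambda>n. \<phi> (word [n])) f"
  proof (induction f rule: free_alg_induct)
    case zero
    show ?case using *(4) [of 0 0] by simp
  next
    case (word c w)
    show ?case unfolding *(4) hom_fscale hom_word on_words [of w] ..
  qed (simp add: *(3) hom_add)
qed

text \<open>The universal property of the free algebra turns quantification over homomorphisms into
  quantification over arbitrary images of the letters.\<close>

lemma ball_alg_hom: "(\<forall>\<phi>. alg_hom fscale sc \<phi> \<longrightarrow> Q \<phi>) \<longleftrightarrow> (\<forall>v. Q (hom v))"
proof (intro iffI allI impI)
  fix \<phi> assume "\<forall>v. Q (hom v)" "alg_hom fscale sc \<phi>"
  then show "Q \<phi>" by (subst alg_hom_eq_hom) simp_all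
qed (simp add: alg_hom_hom)

end

interpretation free_alg: scaled_algebra fscale
  by standard (fact fscale_mult_left fscale_mult_right)+

interpretation grassmann: scaled_algebra gscale
  by standard (fact gscale_mult_left gscale_mult_right)+

lemma TG_eq: "TG = {f. \<forall>v. grassmann.hom v f = 0}"
  unfolding TG_def by (simp add: grassmann.ball_alg_hom)

section \<open>Polarisation\<close>

text \<open>The linear part in \<open>s\<close> of the value of a word under \<open>x\<^sub>i \<mapsto> v i + s\<close>.\<close>

primrec polar :: "(nat \<Rightarrow> 'a::ring_1) \<Rightarrow> nat \<Rightarrow> 'a \<Rightarrow> nat list \<Rightarrow> 'a"
  where "polar v i s [] = 0"
  | "polar v i s (c # w) = (if c = i then s * prod_list (map v w) else 0) + v c * polar v i s w"

lemma sandwich_polar: "(\<And>g. s * g * s = 0) \<Longrightarrow> s * g * polar v i s w = 0"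
proof (induction w arbitrary: g)
  case (Cons c w)
  have "s * g * (v c * polar v i s w) = 0"
    using Cons.IH [of "g * v c"] Cons.prems by (simp add: mult.assoc)
  moreover have "s * g * (s * h) = 0" for h
    using Cons.prems [of g] by (simp flip: mult.assoc)
  ultimately show ?case by (simp add: distrib_left)
qed simp

text \<open>Terms with two or more inserted copies of \<open>s\<close> vanish by the sandwich
  condition, so the expansion is exact after its linear part.\<close>

lemma prod_list_shift:
  assumes "\<And>g. s * g * s = 0"
  shows "prod_list (map (v(i := v i + s)) w) = prod_list (map v w) + polar v i s w"
proof (induction w)
  case (Cons c w)
  have "s * polar v i s w = 0" using sandwich_polar [OF assms, of 1] by simp
  then show ?case
    by (cases "c = i") (simp_all add: Cons distrib_left distrib_right fun_upd_same fun_upd_other del: fun_upd_apply)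
qed simp

text \<open>Euler's identity for the degree in the letter \<open>i\<close>: each occurrence is
  replaced by itself once.\<close>

lemma polar_self: "polar v i (v i) w = of_nat (count_list w i) * prod_list (map v w)"
proof (induction w)
  case (Cons c w)
  have "v c * (of_nat n * g) = of_nat n * (v c * g)" for n g
    by (metis mult.assoc mult_of_nat_commute)
  then show ?case by (simp add: Cons distrib_right)
qed simp

lemma (in scaled_algebra) hom_shift:
  assumes "\<And>g. s * g * s = 0"
  shows "hom (v(i := v i + s)) f = hom v f + lin (polar v i s) f"
  unfolding hom_def prod_list_shift [OF assms] by (rule lin_plus_fun)

lemma sum_list_scale: "gscale c (sum_list xs) = sum_list (map (gscale c) xs)"
  by (induction xs) (simp_all add: grassmann.scale_right_distrib)

lemma commutator_mult_right: "commutator a (b * c) = commutator a b * c + b * commutator a c"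
  by (simp add: commutator_def algebra_simps)

section \<open>Moving the increment to the right\<close>

text \<open>Commuting with \<open>s\<close> acts as a derivation along the word, and the resulting
  commutators are even, so they can be moved to the right. The list \<open>L\<close> is chosen
  before \<open>v\<close> and \<open>s\<close>: its coefficients are polynomials, not
  values.\<close>

lemma commutator_word:
  "\<exists>L :: ('k::field free_alg \<times> nat) list. \<forall>v s. commutator s (grassmann.hom v (word w)) =
    (\<Sum>(B, l)\<leftarrow>L. grassmann.hom v B * commutator s (v l))"
proof (induction w)
  case Nil
  show ?case by (intro exI [of _ "[]"]) (simp add: commutator_def)
next
  case (Cons c w)
  then obtain L :: "('k free_alg \<times> nat) list" where L: "\<And>v s. commutator s (grassmann.hom v (word w)) =
    (\<Sum>(B, l)\<leftarrow>L. grassmann.hom v B * commutator s (v l))" by blast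
  show ?case
  proof (intro exI [of _ "(word w, c) # map (\<lambda>(B, l). (word [c] * B, l)) L"] allI)
    fix v :: "nat \<Rightarrow> 'k grassmann" and s
    have "grassmann.hom v (word (c # w)) = v c * grassmann.hom v (word w)"
      by (simp add: grassmann.hom_word)
    moreover have "commutator s (v c) * grassmann.hom v (word w) =
        grassmann.hom v (word w) * commutator s (v c)"
      by (rule geven_commute) simp
    ultimately show "commutator s (grassmann.hom v (word (c # w))) =
      (\<Sum>(B, l)\<leftarrow>(word w, c) # map (\<lambda>(B, l). (word [c] * B, l)) L. grassmann.hom v B * commutator s (v l))"
      by (simp add: commutator_mult_right L grassmann.hom_mult grassmann.hom_word[of v "[c]"]
          case_prod_unfold o_def mult.assoc sum_list_const_mult)
  qed
qed

text \<open>Moving an inserted \<open>s\<close> to the right end of the word costs its commutator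
  with the remaining letters, which \<open>commutator_word\<close> resolves.\<close>

lemma polar_word:
  "\<exists>(A :: 'k::field free_alg) L. \<forall>v s. polar v i s w = grassmann.hom v A * s +
    (\<Sum>(B, l)\<leftarrow>L. grassmann.hom v B * commutator s (v l))"
proof (induction w)
  case Nil
  show ?case by (intro exI [of _ 0] exI [of _ "[]"]) simp
next
  case (Cons c w)
  then obtain A :: "'k free_alg" and L where L: "\<And>v s. polar v i s w = grassmann.hom v A * s +
    (\<Sum>(B, l)\<leftarrow>L. grassmann.hom v B * commutator s (v l))" by blast
  obtain L' :: "('k free_alg \<times> nat) list" where L': "\<And>v s. commutator s (grassmann.hom v (word w)) =
    (\<Sum>(B, l)\<leftarrow>L'. grassmann.hom v B * commutator s (v l))" using commutator_word by blast
  let ?L = "map (\<lambda>(B, l). (word [c] * B, l)) L"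
  have 1: "v c * polar v i s w = grassmann.hom v (word [c] * A) * s +
      (\<Sum>(B, l)\<leftarrow>?L. grassmann.hom v B * commutator s (v l))" for v s
    by (simp add: L distrib_left grassmann.hom_mult grassmann.hom_word
          case_prod_unfold o_def mult.assoc sum_list_const_mult)
  have 2: "s * prod_list (map v w) = grassmann.hom v (word w) * s +
      (\<Sum>(B, l)\<leftarrow>L'. grassmann.hom v B * commutator s (v l))" for v s
    unfolding L' [symmetric] by (simp add: commutator_def grassmann.hom_word)
  show ?case
  proof (cases "c = i")
    case True
    show ?thesis
      by (intro exI [of _ "word w + word [c] * A"] exI [of _ "L' @ ?L"] allI)
        (use True 1 2 in \<open>simp add: grassmann.hom_add distrib_right\<close>)
  next
    case False
    show ?thesis
      by (intro exI [of _ "word [c] * A"] exI [of _ ?L] allI) (use False 1 in simp)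
  qed
qed

lemma polar_decomp:
  "\<exists>A L. \<forall>v s. grassmann.lin (polar v i s) (f :: 'k::field free_alg) = grassmann.hom v A * s +
    (\<Sum>(B, l)\<leftarrow>L. grassmann.hom v B * commutator s (v l))"
proof (induction f rule: free_alg_induct)
  case zero
  show ?case by (intro exI [of _ 0] exI [of _ "[]"]) simp
next
  case (word c w)
  obtain A :: "'k free_alg" and L where L: "\<And>v s. polar v i s w = grassmann.hom v A * s +
    (\<Sum>(B, l)\<leftarrow>L. grassmann.hom v B * commutator s (v l))" using polar_word by blast
  show ?case
    by (intro exI [of _ "fscale c A"] exI [of _ "map (\<lambda>(B, l). (fscale c B, l)) L"] allI)
      (simp add: grassmann.lin_fscale grassmann.lin_word L grassmann.scale_right_distrib
        grassmann.hom_fscale sum_list_scale case_prod_unfold o_def gscale_mult_left)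
next
  case (add f g)
  then obtain A L A' L' where "\<And>v s. grassmann.lin (polar v i s) f = grassmann.hom v A * s +
      (\<Sum>(B, l)\<leftarrow>L. grassmann.hom v B * commutator s (v l))"
    "\<And>v s. grassmann.lin (polar v i s) g = grassmann.hom v A' * s +
      (\<Sum>(B, l)\<leftarrow>L'. grassmann.hom v B * commutator s (v l))" by blast
  then show ?case
    by (intro exI [of _ "A + A'"] exI [of _ "L @ L'"] allI)
      (simp add: grassmann.lin_add grassmann.hom_add distrib_right)
qed

section \<open>Polynomials with central values\<close>

definition central_valued :: "'k::field free_alg set"
  where "central_valued = {f. \<forall>v. grassmann.hom v f \<in> centre}"

lemma T_space_hom:
  assumes "T_space V" "f \<in> V"
  shows "free_alg.hom v f \<in> V"
  using assms free_alg.alg_hom_hom unfolding T_space_def by blast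

lemma T_space_subspace: "T_space V \<Longrightarrow> free_alg.subspace V"
  by (simp add: T_space_def)

lemma subspace_centre: "grassmann.subspace (centre :: 'k::field grassmann set)"
  unfolding grassmann.subspace_def centre_def zero_grassmann.rep_eq
  by (simp add: distrib_left distrib_right gscale_mult_left gscale_mult_right)

lemma hom_hom: "grassmann.hom v (free_alg.hom u f) = grassmann.hom (\<lambda>n. grassmann.hom v (u n)) f"
proof (induction f rule: free_alg_induct)
  case (word c w)
  have "grassmann.hom v (free_alg.hom u (word w)) = grassmann.hom (\<lambda>n. grassmann.hom v (u n)) (word w)"
    by (simp add: free_alg.hom_word grassmann.hom_word grassmann.hom_prod_list o_def)
  then show ?case by (simp add: free_alg.hom_fscale grassmann.hom_fscale)
qed (simp_all add: free_alg.hom_add grassmann.hom_add)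

lemma T_space_central_valued: "T_space (central_valued :: 'k::field free_alg set)"
  unfolding T_space_def
proof (intro conjI allI impI)
  show "free_alg.subspace (central_valued :: 'k free_alg set)"
    unfolding free_alg.subspace_def central_valued_def
    using subspace_centre [where 'k = 'k]
    by (auto simp: grassmann.hom_add grassmann.hom_fscale grassmann.subspace_def)
  fix \<phi> :: "'k free_alg \<Rightarrow> 'k free_alg"
  assume "alg_hom fscale fscale \<phi>"
  then have "\<phi> = free_alg.hom (\<lambda>n. \<phi> (word [n]))" by (rule free_alg.alg_hom_eq_hom)
  then obtain u where "\<phi> = free_alg.hom u" ..
  then show "\<phi> ` central_valued \<subseteq> central_valued"
    by (auto simp: central_valued_def hom_hom)
qed

lemma subspace_TG: "free_alg.subspace (TG :: 'k::field free_alg set)"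
  by (auto simp: TG_eq free_alg.subspace_def grassmann.hom_add grassmann.hom_fscale)

lemma TG_subset_central_valued: "TG \<subseteq> central_valued"
  by (auto simp: TG_eq central_valued_def centre_def)

lemma CPG_eq_central_valued: "CPG = (central_valued :: 'k::field free_alg set)"
proof
  have cp: "{f. central_polynomial f} = central_valued - (TG :: 'k free_alg set)"
    unfolding central_polynomial_def central_valued_def by (auto simp: grassmann.ball_alg_hom)
  show "CPG \<subseteq> (central_valued :: 'k free_alg set)"
    unfolding CPG_def T_space_gen_def cp
    by (rule hull_minimal) (use T_space_central_valued in auto)
  have base: "f \<in> CPG" if "f \<in> central_valued" "f \<notin> TG" for f :: "'k free_alg"
    unfolding CPG_def T_space_gen_def by (rule hull_inc) (use that cp in blast)
  have subspace: "free_alg.subspace (CPG :: 'k free_alg set)"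
    unfolding CPG_def by (rule T_space_subspace [OF T_space_T_space_gen])
  show "central_valued \<subseteq> (CPG :: 'k free_alg set)"
  proof
    fix f :: "'k free_alg"
    assume f: "f \<in> central_valued"
    show "f \<in> CPG"
    proof (cases "f \<in> TG")
      case True
      \<comment> \<open>An element of \<open>TG\<close> is not itself a central polynomial, but it
        is the difference of the two central polynomials \<open>f + 1\<close> and
        \<open>1\<close>.\<close>
      have one: "1 \<in> central_valued" "1 \<notin> (TG :: 'k free_alg set)"
        by (simp_all add: central_valued_def TG_eq centre_def)
      have "f + 1 \<in> central_valued"
        using free_alg.subspace_add [OF T_space_subspace [OF T_space_central_valued] f one(1)] .
      moreover have "f + 1 \<notin> TG"
        using free_alg.subspace_diff [OF subspace_TG _ True, of "f + 1"] one(2) by auto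
      ultimately have "f + 1 - 1 \<in> CPG"
        using one by (intro free_alg.subspace_diff [OF subspace] base)
      then show ?thesis by simp
    qed (use base f in blast)
  qed
qed

lemma subspace_set_plus:
  "free_alg.subspace (A :: 'k::field free_alg set) \<Longrightarrow> free_alg.subspace B \<Longrightarrow> free_alg.subspace (A + B)"
proof -
  have "A + B = {x + y |x y. x \<in> A \<and> y \<in> B}" by (auto simp: set_plus_def)
  then show "free_alg.subspace A \<Longrightarrow> free_alg.subspace B \<Longrightarrow> free_alg.subspace (A + B)"
    by (simp add: free_alg.subspace_sums)
qed

section \<open>Derivatives of central polynomials\<close>

text \<open>The Euler operator in the letter \<open>i\<close>: words are its eigenvectors, and the
  eigenvalues are their degrees read in the field.\<close>

lift_definition degree_op :: "nat \<Rightarrow> 'k::field free_alg \<Rightarrow> 'k free_alg"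
  is "\<lambda>i f m. of_nat (count_list (letters m) i) * f m"
  by (auto elim: rev_finite_subset)

lemma hom_degree_op: "grassmann.hom v (degree_op i f) = grassmann.lin (polar v i (v i)) f"
proof -
  have "Poly_Mapping.keys (degree_op i f) \<subseteq> Poly_Mapping.keys f"
    by (auto simp: in_keys_iff degree_op.rep_eq)
  then have "grassmann.hom v (degree_op i f) = (\<Sum>m\<in>Poly_Mapping.keys f.
      gscale (Poly_Mapping.lookup (degree_op i f) m) (prod_list (map v (letters m))))"
    unfolding grassmann.hom_def by (intro grassmann.lin_superset) auto
  then show ?thesis
    unfolding grassmann.lin_def polar_self
    by (simp add: degree_op.rep_eq of_nat_grassmann [of "count_list _ _"] gscale_mult_left mult.commute)
qed

context
  assumes two: "(2 :: 'k::field) \<noteq> 0"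
begin

text \<open>The sandwich condition leaves no higher terms, so the linear part is a difference of two
  values of \<open>f\<close>.\<close>

lemma polar_central:
  assumes "(f :: 'k free_alg) \<in> central_valued" and "\<And>g. s * g * s = 0"
  shows "geven (grassmann.lin (polar v i s) f)"
proof -
  have "geven (grassmann.hom (v(i := v i + s)) f)" "geven (grassmann.hom v f)"
    using assms(1) mem_centre_iff [OF two] by (auto simp: central_valued_def)
  then show ?thesis
    using geven_diff [of "grassmann.hom (v(i := v i + s)) f" "grassmann.hom v f"]
    by (simp add: grassmann.hom_shift [OF assms(2)])
qed

lemma degree_op_central:
  assumes f: "(f :: 'k free_alg) \<in> central_valued"
  obtains gs where "degree_op i f - (\<Sum>(g, h)\<leftarrow>gs. commutator g h) \<in> TG"
proof -
  obtain A L where AL: "\<And>v s. grassmann.lin (polar v i s) f = grassmann.hom v A * s +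
      (\<Sum>(B, l)\<leftarrow>L. grassmann.hom v B * commutator s (v l))" using polar_decomp [of i f] by blast
  have even_A: "geven (grassmann.hom v A)" for v
  proof -
    let ?a = "grassmann.hom v A"
    have "gen j * (gen k * odd_part ?a) = 0" for j k
    proof -
      \<comment> \<open>A product of two generators is central, so the commutator terms vanish and
        \<open>A\<close> is tested alone: \<open>A * s\<close> must be even.\<close>
      let ?s = "gen j * gen k :: 'k grassmann"
      have s: "geven ?s" by (rule geven_times_odd) simp_all
      have "?s * g * ?s = 0" for g
        using godd_sandwich [OF two godd_gen, of j "gen k * g"] by (simp flip: mult.assoc)
      then have "geven (grassmann.lin (polar v i ?s) f)" by (rule polar_central [OF f])
      moreover have "commutator ?s b = 0" for b
        using geven_commute [OF s, of b] by (simp add: commutator_def)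
      ultimately have "geven (?a * ?s)" by (simp add: AL case_prod_unfold)
      then have "geven (?a * ?s - even_part ?a * ?s)"
        by (rule geven_diff) (rule geven_times [OF geven_even_part s])
      also have "?a * ?s - even_part ?a * ?s = odd_part ?a * ?s"
        using arg_cong [OF even_odd_decomp [of ?a], of "\<lambda>x. x * ?s"] by (simp only: distrib_right) simp
      finally have "odd_part ?a * ?s = 0"
        by (rule geven_godd_imp_0) (rule godd_times_left [OF godd_odd_part s])
      then show ?thesis by (simp only: geven_commute [OF s, of "odd_part ?a", symmetric] mult.assoc)
    qed
    then have "odd_part ?a = 0" by (rule eq_0_if_gen_times_eq_0 [OF eq_0_if_gen_times_eq_0])
    then have "?a = even_part ?a" using even_odd_decomp [of ?a] by simp
    then show ?thesis by (metis geven_even_part)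
  qed
  have A: "grassmann.hom v A = (\<Sum>(B, l)\<leftarrow>L. commutator (grassmann.hom v B) (v l))" for v
  proof -
    let ?Z = "grassmann.hom v A - (\<Sum>(B, l)\<leftarrow>L. commutator (grassmann.hom v B) (v l))"
    have Z: "geven ?Z"
    proof (rule geven_diff [OF even_A])
      show "geven (\<Sum>(B, l)\<leftarrow>L. commutator (grassmann.hom v B) (v l))"
        by (induction L) auto
    qed
    have "gen j * ?Z = 0" for j
    proof -
      \<comment> \<open>A single generator is odd and also tests the commutator terms. Modulo even
        elements, \<open>geven_commutator_shift\<close> replaces \<open>?P\<close> by
        \<open>- ?C * ?s\<close>.\<close>
      let ?s = "gen j :: 'k grassmann"
      let ?P = "\<Sum>(B, l)\<leftarrow>L. grassmann.hom v B * commutator ?s (v l)"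
        and ?C = "\<Sum>(B, l)\<leftarrow>L. commutator (grassmann.hom v B) (v l)"
      have "geven (grassmann.lin (polar v i ?s) f)"
        by (rule polar_central [OF f]) (simp add: godd_sandwich [OF two])
      then have 1: "geven (grassmann.hom v A * ?s + ?P)" by (simp only: AL)
      have 2: "geven (?P + ?C * ?s)"
      proof (induction L)
        case (Cons x L)
        obtain B l where x: "x = (B, l)" by fastforce
        have "geven ((grassmann.hom v B * commutator ?s (v l) + commutator (grassmann.hom v B) (v l) * ?s) +
          ((\<Sum>(B, l)\<leftarrow>L. grassmann.hom v B * commutator ?s (v l)) +
          (\<Sum>(B, l)\<leftarrow>L. commutator (grassmann.hom v B) (v l)) * ?s))"
          by (intro geven_add geven_commutator_shift two Cons) simp
        then show ?case by (simp add: x distrib_right add_ac)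
      qed simp
      have "(grassmann.hom v A * ?s + ?P) - (?P + ?C * ?s) = ?Z * ?s"
        by (simp add: left_diff_distrib)
      then have "geven (?Z * ?s)" using geven_diff [OF 1 2] by (simp only:)
      then have "?Z * ?s = 0" by (rule geven_godd_imp_0) (rule godd_times_right [OF Z godd_gen])
      then show ?thesis using geven_commute [OF Z, of ?s] by simp
    qed
    then have "?Z = 0" by (rule eq_0_if_gen_times_eq_0)
    then show ?thesis by simp
  qed
  show ?thesis
  \<comment> \<open>With \<open>s = x_i\<close>, the formula for \<open>A\<close> lets
    \<open>[B, x_l] x_i + B [x_i, x_l]\<close> combine into \<open>[B x_i, x_l]\<close>, which gives
    the pairs of the witness.\<close>
  proof (rule that [of "map (\<lambda>(B, l). (B * word [i], word [l])) L"])
    have "grassmann.hom v (degree_op i f) =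
        (\<Sum>(B, l)\<leftarrow>L. commutator (grassmann.hom v B * v i) (v l))" for v
    proof -
      have "commutator a b * c + a * commutator c b = commutator (a * c) b" for a b c :: "'k grassmann"
        by (simp add: commutator_def algebra_simps)
      then show ?thesis
        unfolding hom_degree_op AL A
        by (simp add: case_prod_unfold flip: sum_list_addf sum_list_mult_const)
    qed
    then show "degree_op i f - (\<Sum>(g, h)\<leftarrow>map (\<lambda>(B, l). (B * word [i], word [l])) L. commutator g h) \<in> TG"
      by (simp add: TG_eq grassmann.hom_diff grassmann.hom_sum_list case_prod_unfold o_def
          grassmann.hom_commutator grassmann.hom_mult grassmann.hom_word)
  qed
qed

end

section \<open>Generators of the space of central polynomials\<close>

definition commutator_prod :: "(nat \<times> nat) list \<Rightarrow> 'k::field free_alg"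
  where "commutator_prod L = (\<Prod>(a, b)\<leftarrow>L. commutator (word [a]) (word [b]))"

abbreviation flatten_pairs :: "('x \<times> 'x) list \<Rightarrow> 'x list"
  where "flatten_pairs L \<equiv> concat (map (\<lambda>(a, b). [a, b]) L)"

lemma hom_commutator_prod:
  "grassmann.hom v (commutator_prod L) = (\<Prod>(a, b)\<leftarrow>L. commutator (v a) (v b))"
  by (simp add: commutator_prod_def grassmann.hom_prod_list grassmann.hom_commutator
      grassmann.hom_word case_prod_unfold o_def)

section \<open>Reordering words modulo the identities of the Grassmann algebra\<close>

text \<open>Adjacent transpositions generate all rearrangements. The prefix \<open>u\<close> lets
  the induction act inside a longer word, and swaps are demanded only for words of the fixed content
  \<open>M\<close>.\<close>

lemma rel_if_mset_eq:
  assumes refl: "\<And>w. R w w" and trans: "\<And>u v w. R u v \<Longrightarrow> R v w \<Longrightarrow> R u w"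
    and swap: "\<And>u x y z. mset (u @ x # y # z) = M \<Longrightarrow> R (u @ x # y # z) (u @ y # x # z)"
  shows "mset (u @ w) = M \<Longrightarrow> mset w = mset w' \<Longrightarrow> R (u @ w) (u @ w')"
proof (induction w arbitrary: u w')
  case Nil
  then show ?case using refl by simp
next
  case (Cons x w)
  have move: "R (u @ x # a @ b) (u @ a @ x # b)" if "mset (u @ x # a @ b) = M" for u a b
    using that
  proof (induction a arbitrary: u)
    case Nil
    then show ?case using refl by simp
  next
    case (Cons y a)
    have "R (u @ x # y # a @ b) (u @ y # x # a @ b)" using Cons.prems by (intro swap) simp
    moreover have "R ((u @ [y]) @ x # a @ b) ((u @ [y]) @ a @ x # b)"
      using Cons.prems by (intro Cons.IH) (simp add: add_mset_commute)
    ultimately show ?case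
      using trans [of "u @ x # y # a @ b" "u @ y # x # a @ b" "u @ y # a @ x # b"] by simp
  qed
  have "x \<in> set w'" using Cons.prems(2) by (metis list.set_intros(1) mset_eq_setD)
  then obtain a b where w': "w' = a @ x # b" by (meson split_list)
  then have mset: "mset w = mset (a @ b)" using Cons.prems(2) by simp
  have "R ((u @ [x]) @ w) ((u @ [x]) @ a @ b)"
    using Cons.prems(1) mset by (intro Cons.IH) simp_all
  moreover have "R (u @ x # a @ b) (u @ a @ x # b)"
    using Cons.prems(1) mset by (intro move) simp
  ultimately show ?case using trans [of "u @ x # w" "u @ x # a @ b" "u @ a @ x # b"] w' by simp
qed

lemma word_concat_replicate: "word (concat (replicate n w)) = word w ^ n"
  by (induction n) (simp_all add: word_append)

lemma word_replicate: "word (replicate n a) = word [a] ^ n"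
  by (induction n) (simp_all add: word_Cons [of a "replicate _ a"])

text \<open>The two words differ by \<open>u [x, y] z\<close>, and the commutator, central in
  \<open>G\<close>, passes \<open>z\<close> to join the product.\<close>

lemma swap_mem_TG:
  "word (u @ x # y # z) * commutator_prod L - word (u @ y # x # z) * commutator_prod L -
    word (u @ z) * commutator_prod ((x, y) # L) \<in> (TG :: 'k::field free_alg set)"
proof -
  have "a * (b * (c * d)) * g - a * (c * (b * d)) * g - a * d * (commutator b c * g) = 0"
    for a b c d g :: "'k::field grassmann"
  proof -
    have "d * (commutator b c * g) = commutator b c * d * g"
      using geven_commute [of "commutator b c" d] by (simp add: mult.assoc)
    then show ?thesis by (simp add: mult.assoc) (simp add: commutator_def algebra_simps)
  qed
  then show ?thesis
    by (simp add: TG_eq grassmann.hom_diff grassmann.hom_mult grassmann.hom_word hom_commutator_prod)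
qed

text \<open>Commutators are central in \<open>G\<close>, so each can be brought in front of the
  powers of its own letters, as in the generators of \<open>S1\<close>.\<close>

lemma prod_list_commutators_powers:
  "(\<Prod>(a, b)\<leftarrow>L. v a ^ n * v b ^ n) * (\<Prod>(a, b)\<leftarrow>L. commutator (v a) (v b)) =
    (\<Prod>(a, b)\<leftarrow>L. commutator (v a) (v b) * v a ^ n * (v b ^ n :: 'k::field grassmann))"
proof (induction L)
  case (Cons x L)
  obtain a b where x: "x = (a, b)" by fastforce
  let ?c = "commutator (v a) (v b)" and ?q = "v a ^ n * v b ^ n"
    and ?P = "\<Prod>(a, b)\<leftarrow>L. v a ^ n * v b ^ n" and ?C = "\<Prod>(a, b)\<leftarrow>L. commutator (v a) (v b)"
  have "?q * ?P * (?c * ?C) = ?c * ?q * (?P * ?C)"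
    using arg_cong [OF geven_commute [OF geven_commutator, of "v a" "v b" "?q * ?P"], of "\<lambda>x. x * ?C"]
    by (simp only: mult.assoc)
  then show ?case unfolding x by (simp add: Cons mult.assoc)
qed simp

lemma not_distinct_mem_TG:
  assumes "(2 :: 'k::field) \<noteq> 0" and "\<not> distinct (flatten_pairs L)"
  shows "word w * commutator_prod L \<in> (TG :: 'k free_alg set)"
  using prod_list_odd_eq_0 [OF assms(1) _ assms(2)]
  by (simp add: TG_eq grassmann.hom_mult hom_commutator_prod prod_list_commutators)

text \<open>Counting from \<open>0\<close> writes the variables as \<open>X (Suc n)\<close>, the
  form that \<open>hom_X_Suc\<close> evaluates.\<close>

lemma S1_eq: "S1 p = T_space_gen {commutator (X 1) (X 2), X 1 ^ p} +
    T_space_gen {X 1 ^ p * (\<Prod>i\<leftarrow>[0..<t]. commutator (X (Suc (2 * i + 1))) (X (Suc (2 * i + 2))) *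
      X (Suc (2 * i + 1)) ^ (p - 1) * X (Suc (2 * i + 2)) ^ (p - 1)) |t. t \<ge> 1}"
proof -
  have "[1..<t + 1] = map Suc [0..<t]" for t by (simp add: map_Suc_upt)
  then show ?thesis unfolding S1_def by (simp add: o_def)
qed

section \<open>The space \<open>S1\<close> and substitution instances of its generators\<close>

lemma subspace_S1: "free_alg.subspace (S1 p :: 'k::field free_alg set)"
  unfolding S1_def by (intro subspace_set_plus T_space_subspace T_space_T_space_gen)

lemma subset_set_plus_left: "free_alg.subspace (B :: 'k::field free_alg set) \<Longrightarrow> A \<subseteq> A + B"
  by (rule subsetI) (metis add.right_neutral free_alg.subspace_0 set_plus_intro)

lemma subset_set_plus_right: "free_alg.subspace (A :: 'k::field free_alg set) \<Longrightarrow> B \<subseteq> A + B"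
  by (rule subsetI) (metis add.left_neutral free_alg.subspace_0 set_plus_intro)

lemma T_space_gen_subset: "B \<subseteq> V \<Longrightarrow> T_space V \<Longrightarrow> T_space_gen B \<subseteq> V"
  unfolding T_space_gen_def by (rule hull_minimal)

lemma T_space_gen_hom: "f \<in> B \<Longrightarrow> free_alg.hom v f \<in> T_space_gen B"
  by (rule T_space_hom [OF T_space_T_space_gen]) (simp add: T_space_gen_def hull_inc)

lemma S1_I1: "f \<in> T_space_gen {commutator (X 1) (X 2), X 1 ^ p} \<Longrightarrow> f \<in> S1 p"
  unfolding S1_def by (rule subsetD [OF subset_set_plus_left])
    (intro T_space_subspace T_space_T_space_gen)

lemma commutator_mem_S1: "commutator f g \<in> S1 p"
proof -
  let ?v = "\<lambda>n :: nat. if n = 0 then f else g"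
  have "free_alg.hom ?v (commutator (X (Suc 0)) (X (Suc (Suc 0)))) = commutator (?v 0) (?v (Suc 0))"
    by (simp only: free_alg.hom_commutator free_alg.hom_X_Suc)
  then have "free_alg.hom ?v (commutator (X 1) (X 2)) = commutator f g"
    by (simp add: numeral_2_eq_2)
  then show ?thesis by (metis S1_I1 T_space_gen_hom insertI1)
qed

lemma power_mem_S1: "f ^ p \<in> S1 p"
proof -
  have "free_alg.hom (\<lambda>n. f) (X (Suc 0) ^ p) = f ^ p"
    by (simp only: free_alg.hom_power free_alg.hom_X_Suc)
  then have "free_alg.hom (\<lambda>n. f) (X 1 ^ p) = f ^ p" by simp
  then show ?thesis by (metis S1_I1 T_space_gen_hom insertI1 insertI2)
qed

lemma prod_mem_S1:
  assumes "L \<noteq> []"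
  shows "f ^ p * (\<Prod>(a, b)\<leftarrow>L. commutator a b * a ^ (p - 1) * b ^ (p - 1)) \<in> S1 p"
proof -
  let ?F = "\<lambda>(a, b). commutator a b * a ^ (p - 1) * (b ^ (p - 1) :: 'a free_alg)"
  let ?g = "X (Suc 0) ^ p * (\<Prod>i\<leftarrow>[0..<length L]. commutator (X (Suc (2 * i + 1))) (X (Suc (2 * i + 2))) *
      X (Suc (2 * i + 1)) ^ (p - 1) * X (Suc (2 * i + 2)) ^ (p - 1))"
  \<comment> \<open>Letter \<open>0\<close> carries \<open>f\<close>. Letters
    \<open>2 * i + 1\<close> and \<open>2 * i + 2\<close> both give the index \<open>i\<close>, and
    parity selects the component of the pair.\<close>
  let ?v = "\<lambda>n. if n = 0 then f else let ab = L ! ((n - 1) div 2) in if odd n then fst ab else snd ab"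
  have "free_alg.hom ?v ?g = f ^ p * (\<Prod>i\<leftarrow>[0..<length L]. ?F (L ! i))"
    by (simp add: free_alg.hom_mult free_alg.hom_power free_alg.hom_X_Suc free_alg.hom_prod_list
        free_alg.hom_commutator o_def case_prod_unfold Let_def)
  also have "map (\<lambda>i. ?F (L ! i)) [0..<length L] = map ?F L"
    by (rule nth_equalityI) simp_all
  finally have "f ^ p * prod_list (map ?F L) = free_alg.hom ?v ?g" ..
  moreover have "length L \<ge> 1" using assms by (cases L) simp_all
  ultimately have "f ^ p * prod_list (map ?F L) \<in> T_space_gen {X 1 ^ p * (\<Prod>i\<leftarrow>[0..<t].
      commutator (X (Suc (2 * i + 1))) (X (Suc (2 * i + 2))) *
      X (Suc (2 * i + 1)) ^ (p - 1) * X (Suc (2 * i + 2)) ^ (p - 1)) |t. t \<ge> 1}" (is "_ \<in> T_space_gen ?B")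
    by (simp only:, intro T_space_gen_hom) auto
  then show ?thesis
    unfolding S1_eq using subset_set_plus_right [OF T_space_subspace [OF T_space_T_space_gen]] by blast
qed

lemma subspace_diff_iff:
  "free_alg.subspace U \<Longrightarrow> f - g \<in> U \<Longrightarrow> f \<in> U \<longleftrightarrow> g \<in> (U :: 'k::field free_alg set)"
  using free_alg.subspace_add [of U "f - g" g] free_alg.subspace_diff [of U f "f - g"] by auto

lemma CHAR_imp_two_nonzero: "CHAR('k::field) > 2 \<Longrightarrow> (2 :: 'k) \<noteq> 0"
  using of_nat_eq_0_iff_char_dvd [where 'a = 'k, of 2] by (auto dest: dvd_imp_le)

text \<open>Modulo \<open>p\<close>, a letter from the pairs occurs \<open>p - 1\<close> times in
  \<open>w\<close> and any other letter \<open>0\<close> times. Once these \<open>p - 1\<close>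
  copies are removed, all multiplicities are divisible by \<open>p\<close>, and \<open>M\<close>
  takes the quotients.\<close>

lemma exists_root_word:
  assumes dvd: "\<And>i. (p::nat) dvd count (mset (w @ flatten_pairs L)) i"
    and "distinct (flatten_pairs L)" and "p > 0"
  obtains M where "mset w =
    mset (concat (replicate p M) @ concat (map (\<lambda>(a, b). replicate (p - 1) a @ replicate (p - 1) b) L))"
proof -
  obtain M where M: "mset M = (\<Sum>i\<in>set w. replicate_mset (count (mset w) i div p) i)"
    using ex_mset by blast
  have "count (mset M) i = (\<Sum>j\<in>set w. if j = i then count (mset w) i div p else 0)" for i
    unfolding M count_sum by (rule sum.cong) auto
  then have M': "count (mset M) i = count (mset w) i div p" for i
    by (cases "i \<in> set w") (simp_all add: not_in_iff [of _ "mset w", THEN iffD1])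
  have power: "count (mset (concat (replicate n M))) i = n * count (mset M) i" for i n
    by (induction n) simp_all
  have pairs: "count (mset (concat (map (\<lambda>(a, b). replicate n a @ replicate n b) L))) i =
      n * count (mset (flatten_pairs L)) i" for i n
    by (induction L) auto
  \<comment> \<open>If \<open>c = 1\<close>, then \<open>n\<close> is \<open>p - 1\<close> modulo
    \<open>p\<close>, and \<open>n div p\<close> is one less than the quotient of
    \<open>n + 1\<close> by \<open>p\<close>.\<close>
  have div: "n = p * (n div p) + (p - 1) * c" if pc: "p dvd n + c" "c \<le> 1" for n c
  proof (cases "c = 0")
    case False
    then have "c = 1" using pc(2) by simp
    then obtain k where k: "n + 1 = p * k" using pc(1) \<open>c = 1\<close> unfolding dvd_def by blast
    then obtain k' where k': "k = Suc k'" by (cases k) simp_all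
    then have n: "n = p * k' + (p - 1)" using k \<open>p > 0\<close> by simp
    have "n div p = k'" unfolding n
      by (rule div_nat_eqI) (use \<open>p > 0\<close> in simp_all)
    then show ?thesis using n False \<open>c \<le> 1\<close> by simp
  qed (use pc in simp)
  have "count (mset w) i = p * (count (mset w) i div p) + (p - 1) * count (mset (flatten_pairs L)) i" for i
  proof (rule div)
    show "p dvd count (mset w) i + count (mset (flatten_pairs L)) i" using dvd [of i] by simp
    show "count (mset (flatten_pairs L)) i \<le> 1"
      using assms(2) unfolding distinct_count_atmost_1 by simp
  qed
  then show ?thesis
    by (intro that [of M] multiset_eqI) (simp only: mset_append count_union power pairs M')
qed

section \<open>The two inclusions\<close>

context
  fixes p :: nat
  assumes char: "CHAR('k::field) = p" and p: "p > 2"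
begin

lemma two_nonzero: "(2 :: 'k) \<noteq> 0"
  using CHAR_imp_two_nonzero char p by blast

lemma subspace_S1_TG: "free_alg.subspace (S1 p + TG :: 'k free_alg set)"
  by (rule subspace_set_plus [OF subspace_S1 subspace_TG])

lemma TG_subset: "(TG :: 'k free_alg set) \<subseteq> S1 p + TG"
  and S1_subset: "(S1 p :: 'k free_alg set) \<subseteq> S1 p + TG"
  by (rule subset_set_plus_right [OF subspace_S1], rule subset_set_plus_left [OF subspace_TG])

text \<open>Polynomials with central values form a T-space, so it suffices to evaluate the
  generators, whose values are products of even elements.\<close>

lemma S1_subset_central_valued: "(S1 p :: 'k free_alg set) \<subseteq> central_valued"
proof -
  have central: "f \<in> central_valued \<longleftrightarrow> (\<forall>v. geven (grassmann.hom v f))" for f :: "'k free_alg"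
    by (simp add: central_valued_def mem_centre_iff [OF two_nonzero])
  have power: "geven (a ^ p)" for a :: "'k grassmann"
    using geven_power_CHAR [OF two_nonzero char] p by simp
  have prod_list: "geven (prod_list gs)" if "\<forall>g\<in>set gs. geven g" for gs :: "'k grassmann list"
    using that by (induction gs) auto
  have X1: "grassmann.hom v (X 1) = v 0" for v :: "nat \<Rightarrow> 'k grassmann"
    using grassmann.hom_X_Suc [of v 0] by simp
  have "T_space_gen {commutator (X 1) (X 2), X 1 ^ p} \<subseteq> (central_valued :: 'k free_alg set)"
  proof (rule T_space_gen_subset [OF _ T_space_central_valued])
    show "{commutator (X 1) (X 2), X 1 ^ p} \<subseteq> (central_valued :: 'k free_alg set)"
      by (auto simp: central grassmann.hom_commutator grassmann.hom_power power)
  qed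
  moreover have "T_space_gen {X 1 ^ p * (\<Prod>i\<leftarrow>[1..<t + 1]. commutator (X (2 * i)) (X (2 * i + 1)) *
      X (2 * i) ^ (p - 1) * X (2 * i + 1) ^ (p - 1)) |t. t \<ge> 1} \<subseteq> (central_valued :: 'k free_alg set)"
  proof (rule T_space_gen_subset [OF _ T_space_central_valued], clarify)
    fix t
    show "X 1 ^ p * (\<Prod>i\<leftarrow>[1..<t + 1]. commutator (X (2 * i)) (X (2 * i + 1)) *
      X (2 * i) ^ (p - 1) * X (2 * i + 1) ^ (p - 1)) \<in> (central_valued :: 'k free_alg set)"
      unfolding central grassmann.hom_mult grassmann.hom_prod_list map_map
      by (intro allI geven_times prod_list)
        (auto simp: grassmann.hom_mult grassmann.hom_power grassmann.hom_commutator power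
          intro!: geven_commutator_powers two_nonzero)
  qed
  ultimately show ?thesis
    unfolding S1_def using free_alg.subspace_add [OF T_space_subspace [OF T_space_central_valued]]
    by (fastforce elim!: set_plus_elim)
qed

lemma S1_TG_subset_central_valued: "(S1 p + TG :: 'k free_alg set) \<subseteq> central_valued"
  using S1_subset_central_valued TG_subset_central_valued
    free_alg.subspace_add [OF T_space_subspace [OF T_space_central_valued]]
  by (fastforce elim!: set_plus_elim)

text \<open>Each swap in \<open>w\<close> leaves a correction term in which two letters have passed
  from the word to \<open>L\<close>. The word is shorter but the joint content is unchanged, so the
  induction hypothesis covers it.\<close>

lemma word_commutator_prod_mem:
  assumes "\<And>i. p dvd count (mset (w @ flatten_pairs L)) i"
  shows "word w * commutator_prod L \<in> (S1 p + TG :: 'k free_alg set)"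
  using assms
proof (induction "length w" arbitrary: w L rule: less_induct)
  case less
  let ?U = "S1 p + TG :: 'k free_alg set"
  let ?t = "\<lambda>w. word w * commutator_prod L :: 'k free_alg"
  note diff_iff = subspace_diff_iff [OF subspace_S1_TG]
  show ?case
  proof (cases "distinct (flatten_pairs L)")
    case False
    then show ?thesis using not_distinct_mem_TG [OF two_nonzero] TG_subset by blast
  next
    case True
    obtain M where M: "mset w =
        mset (concat (replicate p M) @ concat (map (\<lambda>(a, b). replicate (p - 1) a @ replicate (p - 1) b) L))"
        (is "_ = mset ?w'")
      using exists_root_word [OF less.prems True] p by auto
    have swap: "?t (u @ x # y # z) \<in> ?U \<longleftrightarrow> ?t (u @ y # x # z) \<in> ?U" if "mset (u @ x # y # z) = mset w" for u x y z
    proof -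
      have "word (u @ z) * commutator_prod ((x, y) # L) \<in> ?U"
      proof (rule less.hyps)
        show "length (u @ z) < length w" using arg_cong [OF that, of size] by simp
        have "mset ((u @ z) @ flatten_pairs ((x, y) # L)) = mset (w @ flatten_pairs L)"
          using that by (simp add: add_mset_commute flip: that)
        then show "p dvd count (mset ((u @ z) @ flatten_pairs ((x, y) # L))) i" for i
          using less.prems by metis
      qed
      then have "?t (u @ x # y # z) - ?t (u @ y # x # z) \<in> ?U"
        using diff_iff TG_subset swap_mem_TG by blast
      then show ?thesis by (rule diff_iff)
    qed
    have "?t ([] @ w) \<in> ?U \<longleftrightarrow> ?t ([] @ ?w') \<in> ?U"
      by (rule rel_if_mset_eq [where R = "\<lambda>u v. ?t u \<in> ?U \<longleftrightarrow> ?t v \<in> ?U" and M = "mset w"])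
        (use swap M in auto)
    \<comment> \<open>For the arranged word, gathering powers and commutators gives
      \<open>?s\<close> modulo \<open>TG\<close>: an instance of a generator, or a plain
      \<open>p\<close>-th power when \<open>L\<close> is empty.\<close>
    moreover have "?t ?w' \<in> ?U"
    proof -
      let ?L = "map (\<lambda>(a, b). (word [a], word [b])) L :: ('k free_alg \<times> 'k free_alg) list"
      let ?s = "word M ^ p * (\<Prod>(a, b)\<leftarrow>?L. commutator a b * a ^ (p - 1) * b ^ (p - 1))"
      have "?s \<in> S1 p"
        using prod_mem_S1 [of ?L] power_mem_S1 by (cases "L = []") simp_all
      then have "?s \<in> ?U" using S1_subset by blast
      moreover have "?t ?w' - ?s \<in> TG"
      proof -
        have "word (concat (map (\<lambda>(a, b). replicate n a @ replicate n b) L)) =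
            (\<Prod>(a, b)\<leftarrow>L. word [a] ^ n * (word [b] ^ n :: 'k free_alg))" for n
          by (induction L) (auto simp: word_append word_replicate mult.assoc)
        then show ?thesis
          using prod_list_commutators_powers [where 'k = 'k and n = "p - 1" and L = L]
          by (simp add: TG_eq grassmann.hom_diff grassmann.hom_mult grassmann.hom_word hom_commutator_prod
              word_append word_concat_replicate grassmann.hom_power grassmann.hom_prod_list
              grassmann.hom_commutator case_prod_unfold o_def mult.assoc)
      qed
      ultimately show ?thesis using diff_iff TG_subset by blast
    qed
    ultimately show ?thesis by simp
  qed
qed

lemma degree_op_mem:
  assumes "f \<in> (central_valued :: 'k free_alg set)"
  shows "degree_op i f \<in> S1 p + TG"
proof -
  obtain gs where gs: "degree_op i f - (\<Sum>(g, h)\<leftarrow>gs. commutator g h) \<in> TG"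
    using degree_op_central [OF two_nonzero assms] by blast
  have "(\<Sum>(g, h)\<leftarrow>gs. commutator g h) \<in> (S1 p :: 'k free_alg set)"
    by (induction gs)
      (auto intro: free_alg.subspace_0 free_alg.subspace_add subspace_S1 commutator_mem_S1)
  then show ?thesis
    using subspace_diff_iff [OF subspace_S1_TG] gs TG_subset S1_subset by blast
qed

lemma lookup_degree_op_funpow:
  "Poly_Mapping.lookup ((degree_op i ^^ n) f) m =
    of_nat (count_list (letters m) i) ^ n * Poly_Mapping.lookup f m"
  by (induction n) (simp_all add: degree_op.rep_eq mult.assoc)

text \<open>Iteration is possible because \<open>S1 p + TG\<close> consists of polynomials with
  central values, to which \<open>degree_op_mem\<close> applies again.\<close>

lemma degree_op_funpow_mem:
  assumes "f \<in> (central_valued :: 'k free_alg set)"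
  shows "(degree_op i ^^ Suc n) f \<in> S1 p + TG"
proof (induction n)
  case (Suc n)
  then show ?case using degree_op_mem S1_TG_subset_central_valued by auto
qed (use degree_op_mem assms in simp)

text \<open>Degrees lie in the prime field, where Fermat's little theorem applies; the iterated
  degree operator thus becomes a projection.\<close>

lemma of_nat_power_CHAR_minus_1:
  "of_nat n ^ (p - 1) = (if p dvd n then 0 else 1 :: 'k)"
proof -
  have "prime p" using prime_CHAR_semidom [where 'a = 'k] char p by simp
  show ?thesis
  proof (cases "p dvd n")
    case True
    then show ?thesis using of_nat_eq_0_iff_char_dvd [where 'a = 'k, of n] char p by simp
  next
    case False
    then have "[n ^ (p - 1) = 1] (mod p)" using fermat_theorem \<open>prime p\<close> by blast
    then have "of_nat (n ^ (p - 1)) = (of_nat 1 :: 'k)"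
      using of_nat_eq_iff_cong_CHAR [where 'a = 'k] char by blast
    then show ?thesis using False by simp
  qed
qed

lemma central_valued_reduce:
  assumes "finite I" and f: "f \<in> (central_valued :: 'k free_alg set)"
  shows "\<exists>f'. f - f' \<in> S1 p + TG \<and> (\<forall>m. Poly_Mapping.lookup f' m =
    (if \<forall>i\<in>I. p dvd count_list (letters m) i then Poly_Mapping.lookup f m else 0))"
  using assms(1)
proof induction
  case empty
  show ?case by (rule exI [of _ f]) (simp add: free_alg.subspace_0 [OF subspace_S1_TG])
next
  case (insert i I)
  then obtain f' where f': "f - f' \<in> S1 p + TG" "\<And>m. Poly_Mapping.lookup f' m =
    (if \<forall>i\<in>I. p dvd count_list (letters m) i then Poly_Mapping.lookup f m else 0)" by blast
  let ?h = "(degree_op i ^^ (p - 1)) f'"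
  \<comment> \<open>The previous reduction changed \<open>f\<close> only by an element of
    \<open>S1 p + TG\<close>, so central values are preserved.\<close>
  have "f' \<in> central_valued"
    using subspace_diff_iff [OF T_space_subspace [OF T_space_central_valued]] f f'(1)
      S1_TG_subset_central_valued by blast
  \<comment> \<open>As \<open>p - 1 = Suc (p - 2)\<close>, the operator is applied at least
    once.\<close>
  then have "?h \<in> S1 p + TG"
    using degree_op_funpow_mem [where f = f' and i = i and n = "p - 2"] p
    by (simp add: numeral_2_eq_2 Suc_diff_Suc del: funpow.simps)
  then have "f - f' + ?h \<in> S1 p + TG"
    using free_alg.subspace_add [OF subspace_S1_TG] f'(1) by blast
  then have "f - (f' - ?h) \<in> S1 p + TG" by (simp add: algebra_simps)
  moreover have "Poly_Mapping.lookup (f' - ?h) m =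
    (if \<forall>j\<in>insert i I. p dvd count_list (letters m) j then Poly_Mapping.lookup f m else 0)" for m
    by (simp add: lookup_minus lookup_degree_op_funpow f'(2)
        of_nat_power_CHAR_minus_1 [unfolded One_nat_def])
  ultimately show ?case by blast
qed

lemma central_valued_subset: "central_valued \<subseteq> (S1 p + TG :: 'k free_alg set)"
proof
  fix f :: "'k free_alg"
  assume f: "f \<in> central_valued"
  \<comment> \<open>Testing the finitely many letters of \<open>f\<close> controls all degrees,
    since a letter absent from a word has degree \<open>0\<close> there.\<close>
  let ?I = "\<Union>m\<in>Poly_Mapping.keys f. set (letters m)"
  obtain f' where f': "f - f' \<in> S1 p + TG" "\<And>m. Poly_Mapping.lookup f' m =
    (if \<forall>i\<in>?I. p dvd count_list (letters m) i then Poly_Mapping.lookup f m else 0)"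
    using central_valued_reduce [OF _ f, of ?I] by auto
  have mem: "word (letters m) \<in> (S1 p + TG :: 'k free_alg set)" if "m \<in> Poly_Mapping.keys f'" for m
  proof -
    have m: "\<forall>i\<in>?I. p dvd count_list (letters m) i" "m \<in> Poly_Mapping.keys f"
      using that f'(2) [of m] by (auto simp: in_keys_iff split: if_splits)
    then have "p dvd count_list (letters m) i" for i
      by (cases "i \<in> set (letters m)") auto
    then show ?thesis
      using word_commutator_prod_mem [of "letters m" "[]"] by (simp add: commutator_prod_def count_mset)
  qed
  have "f' = (\<Sum>m\<in>Poly_Mapping.keys f'. Poly_Mapping.single m (Poly_Mapping.lookup f' m))"
    by (rule poly_mapping_eqI) (simp add: lookup_sum lookup_single when_def in_keys_iff)
  also have "\<dots> \<in> S1 p + TG"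
    unfolding single_eq_fscale_word
    by (intro free_alg.subspace_sum [OF subspace_S1_TG] free_alg.subspace_scale [OF subspace_S1_TG] mem)
  finally show "f \<in> S1 p + TG"
    using subspace_diff_iff [OF subspace_S1_TG f'(1)] by blast
qed

end

theorem theorem4p1:
  fixes p :: nat
  assumes "CHAR('k::{field,finite}) = p" and "p > 2"
  shows "(CPG :: 'k free_alg set) = S1 p + TG"
  unfolding CPG_eq_central_valued
  using central_valued_subset [OF assms] S1_TG_subset_central_valued [OF assms] by (rule equalityI)

end
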